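(* For $n=3$: (i) the Taylor variety $\mathcal{T}^3_{2,2,3}\subset\mathbb{P}^{19}$ is expected to be a hypersurface (its expected dimension is $18$), but it has codimension two in $\mathbb{P}^{19}$; (ii) the Taylor variety $\mathcal{T}^3_{8,5,9}\subset\mathbb{P}^{219}$ is expected to fill its ambient projective space (its expected dimension is $219$), but it is a hypersurface in $\mathbb{P}^{219}$.
   Context: Work over $\mathbb{C}$ with variables $x=(x_1,\dots,x_n)$. Let $\mathbb{P}^{\binom{n+m}{n}-1}$ be the projective space of nonzero polynomials in $x$ of degree $\le m$ up to scaling. The Taylor variety $\mathcal{T}^n_{d,e,m}\subseteq\mathbb{P}^{\binom{n+m}{n}-1}$ is the Zariski closure of the set of all order-$m$ Taylor polynomials at the origin (Taylor series truncated after total degree $m$) of rational functions $P/Q$ with $P,Q\in\mathbb{C}[x]$, $\deg P\le d$, $\deg Q\le e$, $P(0)=Q(0)=1$. The expected dimension of $\mathcal{T}^n_{d,e,m}$ is $\min\left\{\binom{d+n}{n}+\binom{e+n}{n}-2,\ \binom{m+n}{n}-1\right\}$, which is always an upper bound for its dimension. *)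

theory Defs
  imports "HOL-Analysis.Analysis" "HOL-Library.Poly_Mapping"
begin

section \<open>Multivariate polynomials\<close>

text \<open>A monomial in variables indexed by \<open>'i\<close> is its exponent vector \<open>'i \<Rightarrow>\<^sub>0 nat\<close>; a polynomial maps
  monomials to coefficients with finite support, so that the ring structure is the convolution
  product of \<open>Poly_Mapping\<close>.\<close>

type_synonym 'i cpoly = "('i \<Rightarrow>\<^sub>0 nat) \<Rightarrow>\<^sub>0 complex"

definition mdeg :: "('i \<Rightarrow>\<^sub>0 nat) \<Rightarrow> nat" where
  "mdeg \<mu> = (\<Sum>i\<in>Poly_Mapping.keys \<mu>. Poly_Mapping.lookup \<mu> i)"

definition mono_eval :: "('i \<Rightarrow> complex) \<Rightarrow> ('i \<Rightarrow>\<^sub>0 nat) \<Rightarrow> complex" where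
  "mono_eval v \<mu> = (\<Prod>i\<in>Poly_Mapping.keys \<mu>. v i ^ Poly_Mapping.lookup \<mu> i)"

definition poly_eval :: "('i \<Rightarrow> complex) \<Rightarrow> 'i cpoly \<Rightarrow> complex" where
  "poly_eval v F = (\<Sum>\<mu>\<in>Poly_Mapping.keys F. Poly_Mapping.lookup F \<mu> * mono_eval v \<mu>)"

text \<open>The \<open>n\<close> variables are \<open>x\<^sub>0, \<dots>, x\<^bsub>n-1\<^esub>\<close>.\<close>

definition monomials :: "nat \<Rightarrow> nat \<Rightarrow> (nat \<Rightarrow>\<^sub>0 nat) set" where
  "monomials n m = {\<alpha>. Poly_Mapping.keys \<alpha> \<subseteq> {..<n} \<and> mdeg \<alpha> \<le> m}"

definition polys :: "nat \<Rightarrow> nat \<Rightarrow> nat cpoly set" where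
  "polys n d = {P. Poly_Mapping.keys P \<subseteq> monomials n d}"

definition homogeneous :: "nat \<Rightarrow> 'i cpoly \<Rightarrow> bool" where
  "homogeneous k F \<longleftrightarrow> (\<forall>\<mu>\<in>Poly_Mapping.keys F. mdeg \<mu> = k)"

definition hom_polys :: "'i set \<Rightarrow> 'i cpoly set" where
  "hom_polys I = {F. (\<exists>k. homogeneous k F) \<and> (\<forall>\<mu>\<in>Poly_Mapping.keys F. Poly_Mapping.keys \<mu> \<subseteq> I)}"

section \<open>Projective space and its Zariski topology\<close>

text \<open>Projective space with homogeneous coordinates indexed by \<open>I\<close>; for \<open>I = monomials n m\<close> the vectors
  \<open>p\<close> below are exactly the nonzero elements of \<open>polys n m\<close>.\<close>

definition proj_point :: "('i \<Rightarrow>\<^sub>0 complex) \<Rightarrow> ('i \<Rightarrow>\<^sub>0 complex) set" where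
  "proj_point p = {Poly_Mapping.map ((*) c) p | c. c \<noteq> 0}"

definition proj_space :: "'i set \<Rightarrow> ('i \<Rightarrow>\<^sub>0 complex) set set" where
  "proj_space I = {proj_point p | p. p \<noteq> 0 \<and> Poly_Mapping.keys p \<subseteq> I}"

definition zero_locus :: "'i set \<Rightarrow> 'i cpoly set \<Rightarrow> ('i \<Rightarrow>\<^sub>0 complex) set set" where
  "zero_locus I S = {L \<in> proj_space I. \<forall>F\<in>S. \<forall>p\<in>L. poly_eval (Poly_Mapping.lookup p) F = 0}"

definition zariski :: "'i set \<Rightarrow> ('i \<Rightarrow>\<^sub>0 complex) set topology" where
  "zariski I = topology (\<lambda>U. \<exists>S \<subseteq> hom_polys I. U = proj_space I - zero_locus I S)"

lemma mdeg_superset: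
  assumes "finite A" "Poly_Mapping.keys \<mu> \<subseteq> A"
  shows "mdeg \<mu> = (\<Sum>i\<in>A. Poly_Mapping.lookup \<mu> i)"
  unfolding mdeg_def by (rule sum.mono_neutral_left) (use assms in \<open>auto simp: in_keys_iff\<close>)

lemma mdeg_add: "mdeg (\<mu> + \<nu>) = mdeg \<mu> + mdeg \<nu>"
proof -
  let ?A = "Poly_Mapping.keys \<mu> \<union> Poly_Mapping.keys \<nu>"
  have "Poly_Mapping.keys (\<mu> + \<nu>) \<subseteq> ?A" by (rule Poly_Mapping.keys_add)
  then show ?thesis
    by (simp add: mdeg_superset[of ?A] lookup_add sum.distrib)
qed

lemma mono_eval_superset:
  assumes "finite A" "Poly_Mapping.keys \<mu> \<subseteq> A"
  shows "mono_eval v \<mu> = (\<Prod>i\<in>A. v i ^ Poly_Mapping.lookup \<mu> i)"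
  unfolding mono_eval_def by (rule prod.mono_neutral_left) (use assms in \<open>auto simp: in_keys_iff\<close>)

lemma mono_eval_add: "mono_eval v (\<mu> + \<nu>) = mono_eval v \<mu> * mono_eval v \<nu>"
proof -
  let ?A = "Poly_Mapping.keys \<mu> \<union> Poly_Mapping.keys \<nu>"
  have "Poly_Mapping.keys (\<mu> + \<nu>) \<subseteq> ?A" by (rule Poly_Mapping.keys_add)
  then show ?thesis
    by (simp add: mono_eval_superset[of ?A] lookup_add power_add prod.distrib)
qed

lemma poly_eval_superset:
  assumes "finite A" "Poly_Mapping.keys F \<subseteq> A"
  shows "poly_eval v F = (\<Sum>\<mu>\<in>A. Poly_Mapping.lookup F \<mu> * mono_eval v \<mu>)"
  unfolding poly_eval_def by (rule sum.mono_neutral_left) (use assms in \<open>auto simp: in_keys_iff\<close>)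

lemma poly_eval_add: "poly_eval v (F + G) = poly_eval v F + poly_eval v G"
proof -
  let ?A = "Poly_Mapping.keys F \<union> Poly_Mapping.keys G"
  have "Poly_Mapping.keys (F + G) \<subseteq> ?A" by (rule Poly_Mapping.keys_add)
  then show ?thesis
    by (simp add: poly_eval_superset[of ?A] lookup_add distrib_right sum.distrib)
qed

lemma poly_eval_single: "poly_eval v (Poly_Mapping.single \<mu> c) = c * mono_eval v \<mu>"
  by (simp add: poly_eval_superset[of "{\<mu>}"])

lemma poly_eval_0 [simp]: "poly_eval v 0 = 0"
  by (simp add: poly_eval_def)

lemma poly_eval_1 [simp]: "poly_eval v 1 = 1"
  by (simp add: poly_eval_def mono_eval_def)

lemma poly_eval_sum: "poly_eval v (sum f A) = (\<Sum>a\<in>A. poly_eval v (f a))"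
  by (induction A rule: infinite_finite_induct) (simp_all add: poly_eval_add)

lemma cpoly_eq_sum_single:
  "F = (\<Sum>\<mu>\<in>Poly_Mapping.keys F. Poly_Mapping.single \<mu> (Poly_Mapping.lookup F \<mu>))"
  by (rule poly_mapping_eqI) (auto simp: lookup_sum lookup_single when_def in_keys_iff)

lemma poly_eval_mult: "poly_eval v (F * G) = poly_eval v F * poly_eval v G"
proof -
  have "F * G = (\<Sum>\<mu>\<in>Poly_Mapping.keys F. \<Sum>\<nu>\<in>Poly_Mapping.keys G.
      Poly_Mapping.single (\<mu> + \<nu>) (Poly_Mapping.lookup F \<mu> * Poly_Mapping.lookup G \<nu>))"
    by (subst cpoly_eq_sum_single[of F], subst cpoly_eq_sum_single[of G])
      (simp add: sum_product mult_single)
  then have "poly_eval v (F * G) = (\<Sum>\<mu>\<in>Poly_Mapping.keys F. \<Sum>\<nu>\<in>Poly_Mapping.keys G.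
      Poly_Mapping.lookup F \<mu> * Poly_Mapping.lookup G \<nu> * (mono_eval v \<mu> * mono_eval v \<nu>))"
    by (simp add: poly_eval_sum poly_eval_single mono_eval_add)
  also have "\<dots> = poly_eval v F * poly_eval v G"
    by (simp add: poly_eval_def sum_product algebra_simps)
  finally show ?thesis .
qed

lemma hom_polys_mult:
  assumes "F \<in> hom_polys I" "G \<in> hom_polys I"
  shows "F * G \<in> hom_polys I"
proof -
  obtain k l where k: "homogeneous k F" and l: "homogeneous l G"
    using assms by (auto simp: hom_polys_def)
  have *: "\<exists>\<mu>\<in>Poly_Mapping.keys F. \<exists>\<nu>\<in>Poly_Mapping.keys G. \<kappa> = \<mu> + \<nu>"
    if "\<kappa> \<in> Poly_Mapping.keys (F * G)" for \<kappa>
    using that keys_mult[of F G] by blast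
  have "homogeneous (k + l) (F * G)"
    using k l * by (fastforce simp: homogeneous_def mdeg_add)
  moreover have "Poly_Mapping.keys \<kappa> \<subseteq> I" if \<kappa>: "\<kappa> \<in> Poly_Mapping.keys (F * G)" for \<kappa>
  proof -
    obtain \<mu> \<nu> where "\<mu> \<in> Poly_Mapping.keys F" "\<nu> \<in> Poly_Mapping.keys G" "\<kappa> = \<mu> + \<nu>"
      using *[OF \<kappa>] by blast
    then show ?thesis
      using assms Poly_Mapping.keys_add[of \<mu> \<nu>] by (fastforce simp: hom_polys_def)
  qed
  ultimately show ?thesis by (auto simp: hom_polys_def)
qed

text \<open>A form vanishes at one representative of a point iff it vanishes at all of them.\<close>

lemma poly_eval_proj_point:
  assumes "homogeneous k F" "q \<in> proj_point p"
  shows "poly_eval (Poly_Mapping.lookup q) F = 0 \<longleftrightarrow> poly_eval (Poly_Mapping.lookup p) F = 0"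
proof -
  obtain c where c: "c \<noteq> 0" and q: "q = Poly_Mapping.map ((*) c) p"
    using assms(2) by (auto simp: proj_point_def)
  have lq: "Poly_Mapping.lookup q i = c * Poly_Mapping.lookup p i" for i
    unfolding q by (auto simp: map.rep_eq when_def)
  have "mono_eval (Poly_Mapping.lookup q) \<mu> = c ^ k * mono_eval (Poly_Mapping.lookup p) \<mu>"
    if "\<mu> \<in> Poly_Mapping.keys F" for \<mu>
  proof -
    have "mdeg \<mu> = k" using assms(1) that by (simp add: homogeneous_def)
    then show ?thesis
      by (simp add: mono_eval_def lq power_mult_distrib prod.distrib mdeg_def flip: power_sum)
  qed
  then have "poly_eval (Poly_Mapping.lookup q) F = c ^ k * poly_eval (Poly_Mapping.lookup p) F"
    by (simp add: poly_eval_def sum_distrib_left algebra_simps)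
  then show ?thesis using c by simp
qed

lemma zero_locus_Un:
  assumes "S \<subseteq> hom_polys I" "S' \<subseteq> hom_polys I"
  shows "zero_locus I S \<union> zero_locus I S' = zero_locus I {F * G | F G. F \<in> S \<and> G \<in> S'}"
    (is "?L = ?R")
proof
  show "?L \<subseteq> ?R" by (auto simp: zero_locus_def poly_eval_mult)
  show "?R \<subseteq> ?L"
  proof (rule subsetI, rule ccontr)
    fix L assume L: "L \<in> ?R" and "L \<notin> ?L"
    then obtain p F q G where *: "p \<in> L" "F \<in> S" "poly_eval (Poly_Mapping.lookup p) F \<noteq> 0"
        "q \<in> L" "G \<in> S'" "poly_eval (Poly_Mapping.lookup q) G \<noteq> 0"
      by (auto simp: zero_locus_def)
    obtain r where r: "L = proj_point r" using L by (auto simp: zero_locus_def proj_space_def)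
    obtain l where "homogeneous l G" using * assms by (auto simp: hom_polys_def)
    then have "poly_eval (Poly_Mapping.lookup p) G \<noteq> 0"
      using poly_eval_proj_point[of l G] * r by blast
    moreover have "poly_eval (Poly_Mapping.lookup p) (F * G) = 0"
      using L * by (auto simp: zero_locus_def)
    ultimately show False using * by (simp add: poly_eval_mult)
  qed
qed

lemma istopology_zariski:
  "istopology (\<lambda>U. \<exists>S \<subseteq> hom_polys I. U = proj_space I - zero_locus I S)" (is "istopology ?P")
  unfolding istopology_def
proof (intro conjI allI impI)
  fix U V assume "?P U" "?P V"
  then obtain S S' where S: "S \<subseteq> hom_polys I" "S' \<subseteq> hom_polys I"
    and UV: "U = proj_space I - zero_locus I S" "V = proj_space I - zero_locus I S'" by blast
  have "U \<inter> V = proj_space I - zero_locus I {F * G | F G. F \<in> S \<and> G \<in> S'}"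
    using zero_locus_Un[OF S] UV by blast
  moreover have "{F * G | F G. F \<in> S \<and> G \<in> S'} \<subseteq> hom_polys I"
    using S by (auto intro: hom_polys_mult)
  ultimately show "?P (U \<inter> V)" by blast
next
  fix K assume "\<forall>U\<in>K. ?P U"
  then obtain f where f: "\<And>U. U \<in> K \<Longrightarrow> f U \<subseteq> hom_polys I \<and> U = proj_space I - zero_locus I (f U)"
    by metis
  have "\<Union>K = (\<Union>U\<in>K. proj_space I - zero_locus I (f U))" using f by auto
  also have "\<dots> = proj_space I - zero_locus I (\<Union>U\<in>K. f U)"
    by (auto simp: zero_locus_def)
  finally have "\<Union>K = proj_space I - zero_locus I (\<Union>U\<in>K. f U)" .
  moreover have "(\<Union>U\<in>K. f U) \<subseteq> hom_polys I" using f by blast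
  ultimately show "?P (\<Union>K)" by blast
qed

lemma openin_zariski:
  "openin (zariski I) U \<longleftrightarrow> (\<exists>S \<subseteq> hom_polys I. U = proj_space I - zero_locus I S)"
  unfolding zariski_def by (simp add: topology_inverse'[OF istopology_zariski])

lemma topspace_zariski [simp]: "topspace (zariski I) = proj_space I"
proof -
  have "1 \<in> hom_polys I"
    by (auto simp: hom_polys_def homogeneous_def)
  moreover have "zero_locus I {1} = {}"
    by (auto simp: zero_locus_def proj_space_def proj_point_def intro!: exI[of _ 1])
  ultimately have "openin (zariski I) (proj_space I)"
    unfolding openin_zariski by (intro exI[of _ "{1}"]) simp
  moreover have "U \<subseteq> proj_space I" if "openin (zariski I) U" for U
    using that by (auto simp: openin_zariski)
  ultimately show ?thesis
    by (auto simp: topspace_def)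
qed

lemma closedin_zariski: "closedin (zariski I) X \<longleftrightarrow> (\<exists>S \<subseteq> hom_polys I. X = zero_locus I S)"
proof -
  have "zero_locus I S \<subseteq> proj_space I" for S by (auto simp: zero_locus_def)
  then have "X \<subseteq> proj_space I \<and> proj_space I - X = proj_space I - zero_locus I S \<longleftrightarrow>
      X = zero_locus I S" for S
    by blast
  then show ?thesis
    unfolding closedin_def openin_zariski topspace_zariski by blast
qed

section \<open>Dimension\<close>

definition irreducible_in :: "'a topology \<Rightarrow> 'a set \<Rightarrow> bool" where
  "irreducible_in T Z \<longleftrightarrow> Z \<subseteq> topspace T \<and> Z \<noteq> {} \<and>
    (\<forall>A B. closedin T A \<and> closedin T B \<and> Z \<subseteq> A \<union> B \<longrightarrow> Z \<subseteq> A \<or> Z \<subseteq> B)"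

text \<open>Krull dimension of a nonempty space; the empty space gets \<open>0\<close> instead of the usual \<open>-\<infinity>\<close>.\<close>

definition krull_dim :: "'a topology \<Rightarrow> enat" where
  "krull_dim T = Sup {enat k | k. \<exists>Z :: nat \<Rightarrow> 'a set.
     (\<forall>i\<le>k. closedin T (Z i) \<and> irreducible_in T (Z i)) \<and> (\<forall>i<k. Z i \<subset> Z (Suc i))}"

definition dim_in :: "'a topology \<Rightarrow> 'a set \<Rightarrow> enat" where
  "dim_in T X = krull_dim (subtopology T X)"

text \<open>Meaningful only when \<open>krull_dim T\<close> is finite.\<close>

definition codim_in :: "'a topology \<Rightarrow> 'a set \<Rightarrow> enat" where
  "codim_in T X = krull_dim T - dim_in T X"

text \<open>A hypersurface of projective space is a projective variety (an irreducible Zariski closed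
  subset) of codimension one.\<close>

definition hypersurface_in :: "'a topology \<Rightarrow> 'a set \<Rightarrow> bool" where
  "hypersurface_in T X \<longleftrightarrow> closedin T X \<and> irreducible_in T X \<and> codim_in T X = 1"

section \<open>Taylor varieties\<close>

definition partial_deriv :: "nat \<Rightarrow> ((nat \<Rightarrow> complex) \<Rightarrow> complex) \<Rightarrow> (nat \<Rightarrow> complex) \<Rightarrow> complex" where
  "partial_deriv i f x = deriv (\<lambda>t. f (x(i := t))) (x i)"

text \<open>Mixed partial derivative of multi-index \<open>\<alpha>\<close>: \<open>\<alpha>\<^sub>i\<close> times in \<open>x\<^sub>i\<close> for each \<open>i < n\<close>, where the
  highest-indexed variable is differentiated first.\<close>

definition mixed_deriv ::
    "nat \<Rightarrow> (nat \<Rightarrow>\<^sub>0 nat) \<Rightarrow> ((nat \<Rightarrow> complex) \<Rightarrow> complex) \<Rightarrow> (nat \<Rightarrow> complex) \<Rightarrow> complex" where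
  "mixed_deriv n \<alpha> = foldr (\<lambda>i D. (partial_deriv i ^^ Poly_Mapping.lookup \<alpha> i) \<circ> D) [0..<n] id"

definition taylor_coeff :: "nat \<Rightarrow> ((nat \<Rightarrow> complex) \<Rightarrow> complex) \<Rightarrow> (nat \<Rightarrow>\<^sub>0 nat) \<Rightarrow> complex" where
  "taylor_coeff n f \<alpha> = mixed_deriv n \<alpha> f (\<lambda>_. 0) / (\<Prod>i<n. fact (Poly_Mapping.lookup \<alpha> i))"

definition taylor_poly :: "nat \<Rightarrow> nat \<Rightarrow> ((nat \<Rightarrow> complex) \<Rightarrow> complex) \<Rightarrow> nat cpoly" where
  "taylor_poly n m f = (\<Sum>\<alpha>\<in>monomials n m. Poly_Mapping.single \<alpha> (taylor_coeff n f \<alpha>))"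

text \<open>The sum above has finitely many terms.\<close>

lemma finite_monomials: "finite (monomials n m)"
proof -
  let ?B = "{f. \<forall>i. (i \<in> {..<n} \<longrightarrow> f i \<in> {..m}) \<and> (i \<notin> {..<n} \<longrightarrow> f i = (0::nat))}"
  have "Poly_Mapping.lookup \<alpha> i \<le> m" if "\<alpha> \<in> monomials n m" "i < n" for \<alpha> i
  proof -
    have "mdeg \<alpha> = (\<Sum>i<n. Poly_Mapping.lookup \<alpha> i)"
      using that by (intro mdeg_superset) (auto simp: monomials_def)
    moreover have "Poly_Mapping.lookup \<alpha> i \<le> (\<Sum>i<n. Poly_Mapping.lookup \<alpha> i)"
      using that by (intro member_le_sum) auto
    ultimately show ?thesis using that by (simp add: monomials_def)
  qed
  moreover have "Poly_Mapping.lookup \<alpha> i = 0" if "\<alpha> \<in> monomials n m" "\<not> i < n" for \<alpha> i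
    using that by (metis (no_types, lifting) in_keys_iff lessThan_iff mem_Collect_eq monomials_def subsetD)
  ultimately have "Poly_Mapping.lookup ` monomials n m \<subseteq> ?B" by auto
  moreover have "finite ?B"
    by (rule finite_set_of_finite_funs) (rule finite_lessThan, rule finite_atMost)
  ultimately have "finite (Poly_Mapping.lookup ` monomials n m)" by (rule finite_subset)
  moreover have "inj_on Poly_Mapping.lookup (monomials n m)"
    by (rule inj_onI) (simp add: poly_mapping.lookup_inject)
  ultimately show ?thesis by (rule finite_imageD)
qed

text \<open>Order-\<open>m\<close> Taylor polynomials at the origin of the rational functions \<open>P/Q\<close>, as points of
  projective space. Their constant coefficient is \<open>1\<close>, so they are nonzero.\<close>

definition taylor_points :: "nat \<Rightarrow> nat \<Rightarrow> nat \<Rightarrow> nat \<Rightarrow> nat cpoly set set" where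
  "taylor_points n d e m = {proj_point (taylor_poly n m (\<lambda>x. poly_eval x P / poly_eval x Q)) | P Q.
     P \<in> polys n d \<and> Q \<in> polys n e \<and> poly_eval (\<lambda>_. 0) P = 1 \<and> poly_eval (\<lambda>_. 0) Q = 1}"

abbreviation taylor_space :: "nat \<Rightarrow> nat \<Rightarrow> nat cpoly set topology" where
  "taylor_space n m \<equiv> zariski (monomials n m)"

definition taylor_variety :: "nat \<Rightarrow> nat \<Rightarrow> nat \<Rightarrow> nat \<Rightarrow> nat cpoly set set" where
  "taylor_variety n d e m = taylor_space n m closure_of taylor_points n d e m"

definition expected_dim :: "nat \<Rightarrow> nat \<Rightarrow> nat \<Rightarrow> nat \<Rightarrow> nat" where
  "expected_dim n d e m =
     min (((d + n) choose n) + ((e + n) choose n) - 2) (((m + n) choose n) - 1)"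

end

theory Submission
  imports Defs
begin

text \<open>Dimensions are controlled by the growth of Hilbert functions. If \<open>Z \<subset> Z'\<close> are irreducible and closed and
  a form \<open>f\<close> of degree \<open>\<delta>\<close> vanishes on \<open>Z\<close> but not on \<open>Z'\<close>, then forms of degree \<open>t + \<delta>\<close> independent on
  \<open>Z\<close>, together with the \<open>f\<close>-multiples of forms of degree \<open>t\<close> independent on \<open>Z'\<close>, are independent on \<open>Z'\<close>.
  So the Hilbert function at the top of a chain of length \<open>k\<close> grows at least like \<open>s\<^sup>k\<close>, whereas on a set
  with a dense polynomial parametrisation by \<open>M\<close> parameters it grows at most like \<open>s\<^sup>M\<close>. Lower bounds come
  from the closures of the images of coordinate subspaces of the parameter space.

  For \<open>m = d + 1\<close>, a polynomial \<open>T = 1 + T\<^sub>1 + \<dots> + T\<^sub>m\<close> is a Taylor polynomial of some \<open>P/Q\<close> with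
  \<open>Q = 1 + q\<^sub>1 + \<dots> + q\<^sub>e\<close> iff \<open>T\<^sub>m = - (q\<^sub>1 T\<^bsub>m-1\<^esub> + \<dots> + q\<^sub>e T\<^bsub>m-e\<^esub>)\<close>. For \<open>a + b = m\<close> with \<open>a \<noteq> b\<close> and
  \<open>a, b \<le> e\<close>, the Koszul syzygy \<open>(q\<^sub>a, q\<^sub>b) = (T\<^sub>a, - T\<^sub>b)\<close> is in the kernel of the right hand side, which
  makes the dimension drop by one. Here \<open>(a, b)\<close> is \<open>(1, 2)\<close> and \<open>(4, 5)\<close>, and sparse
  \<open>T\<^sub>1, \<dots>, T\<^bsub>m-1\<^esub>\<close> show that there are no further relations.\<close>

section \<open>Forms vanishing on subsets of projective space\<close>

definition forms :: "'i set \<Rightarrow> nat \<Rightarrow> 'i cpoly set" where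
  "forms I t = {F. homogeneous t F \<and> (\<forall>\<mu>\<in>Poly_Mapping.keys F. Poly_Mapping.keys \<mu> \<subseteq> I)}"

lemma hom_polys_forms: "hom_polys I = (\<Union>t. forms I t)"
  by (auto simp: hom_polys_def forms_def)

lemma forms_hom_polys: "F \<in> forms I t \<Longrightarrow> F \<in> hom_polys I"
  by (auto simp: hom_polys_forms)

lemma forms_add: "F \<in> forms I t \<Longrightarrow> G \<in> forms I t \<Longrightarrow> F + G \<in> forms I t"
  unfolding forms_def homogeneous_def
  using Poly_Mapping.keys_add[of F G] by blast

lemma forms_0 [simp]: "0 \<in> forms I t"
  by (simp add: forms_def homogeneous_def)

lemma forms_sum: "(\<And>a. a \<in> A \<Longrightarrow> f a \<in> forms I t) \<Longrightarrow> sum f A \<in> forms I t"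
  by (induction A rule: infinite_finite_induct) (auto intro: forms_add)

lemma forms_mult:
  assumes "F \<in> forms I s" "G \<in> forms I t"
  shows "F * G \<in> forms I (s + t)"
proof -
  have "mdeg \<kappa> = s + t \<and> Poly_Mapping.keys \<kappa> \<subseteq> I" if \<kappa>: "\<kappa> \<in> Poly_Mapping.keys (F * G)" for \<kappa>
  proof -
    obtain \<mu> \<nu> where "\<mu> \<in> Poly_Mapping.keys F" "\<nu> \<in> Poly_Mapping.keys G" "\<kappa> = \<mu> + \<nu>"
      using \<kappa> keys_mult[of F G] by blast
    then show ?thesis
      using assms Poly_Mapping.keys_add[of \<mu> \<nu>]
      by (fastforce simp: forms_def homogeneous_def mdeg_add)
  qed
  then show ?thesis by (auto simp: forms_def homogeneous_def)
qed

lemma mdeg_0 [simp]: "mdeg 0 = 0"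
  by (simp add: mdeg_def)

lemma mdeg_single [simp]: "mdeg (Poly_Mapping.single i k) = k"
  by (simp add: mdeg_def)

lemma mono_eval_0 [simp]: "mono_eval v 0 = 1"
  by (simp add: mono_eval_def)

lemma forms_const [simp]: "Poly_Mapping.single 0 c \<in> forms I 0"
  by (simp add: forms_def homogeneous_def)

lemma forms_1 [simp]: "1 \<in> forms I 0"
  using forms_const[of 1 I] by simp

lemma forms_smult: "F \<in> forms I t \<Longrightarrow> Poly_Mapping.single 0 c * F \<in> forms I t"
  using forms_mult[OF forms_const, of F I t c] by simp

lemma forms_power: "F \<in> forms I t \<Longrightarrow> F ^ k \<in> forms I (k * t)"
  by (induction k) (auto dest: forms_mult)

definition pvar :: "'i \<Rightarrow> 'i cpoly" where
  "pvar i = Poly_Mapping.single (Poly_Mapping.single i 1) 1"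

lemma poly_eval_pvar [simp]: "poly_eval v (pvar i) = v i"
  by (simp add: pvar_def poly_eval_single mono_eval_def)

lemma forms_pvar: "i \<in> I \<Longrightarrow> pvar i \<in> forms I 1"
  by (simp add: forms_def homogeneous_def pvar_def)

lemma poly_eval_const [simp]: "poly_eval v (Poly_Mapping.single 0 c) = c"
  by (simp add: poly_eval_single)

lemma poly_eval_power: "poly_eval v (F ^ k) = poly_eval v F ^ k"
  by (induction k) (simp_all add: poly_eval_mult)

lemma poly_eval_prod: "poly_eval v (prod f A) = (\<Prod>a\<in>A. poly_eval v (f a))"
  by (induction A rule: infinite_finite_induct) (simp_all add: poly_eval_mult)

lemma poly_eval_uminus: "poly_eval v (- F) = - poly_eval v F"
  using poly_eval_add[of v "F" "- F"] by (simp add: add_eq_0_iff)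

lemma poly_eval_diff: "poly_eval v (F - G) = poly_eval v F - poly_eval v G"
  using poly_eval_add[of v F "- G"] by (simp add: poly_eval_uminus)

definition vanishes :: "('i \<Rightarrow>\<^sub>0 complex) set set \<Rightarrow> 'i cpoly \<Rightarrow> bool" where
  "vanishes Z F \<longleftrightarrow> (\<forall>L\<in>Z. \<forall>p\<in>L. poly_eval (Poly_Mapping.lookup p) F = 0)"

lemma vanishes_mono: "Z \<subseteq> Z' \<Longrightarrow> vanishes Z' F \<Longrightarrow> vanishes Z F"
  by (auto simp: vanishes_def)

lemma subset_zero_locus_iff:
  "Z \<subseteq> proj_space I \<Longrightarrow> Z \<subseteq> zero_locus I S \<longleftrightarrow> (\<forall>F\<in>S. vanishes Z F)"
  by (auto simp: zero_locus_def vanishes_def)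

lemma proj_point_self: "p \<in> proj_point p"
  by (auto simp: proj_point_def intro!: exI[of _ 1] poly_mapping_eqI simp: map.rep_eq when_def)

lemma vanishes_proj_point:
  assumes "F \<in> hom_polys I"
  shows "vanishes {proj_point p} F \<longleftrightarrow> poly_eval (Poly_Mapping.lookup p) F = 0"
  using assms poly_eval_proj_point[of _ F _ p] proj_point_self[of p]
  by (auto simp: hom_polys_def vanishes_def)

lemma vanishes_image:
  assumes "F \<in> hom_polys I"
  shows "vanishes ((\<lambda>v. proj_point (f v)) ` V) F \<longleftrightarrow>
    (\<forall>v\<in>V. poly_eval (Poly_Mapping.lookup (f v)) F = 0)"
  using vanishes_proj_point[OF assms] by (auto simp: vanishes_def)

lemma vanishes_mult_point:
  assumes "F \<in> hom_polys I" "G \<in> hom_polys I"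
  shows "vanishes {proj_point p} (F * G) \<longleftrightarrow>
    vanishes {proj_point p} F \<or> vanishes {proj_point p} G"
  unfolding vanishes_proj_point[OF hom_polys_mult[OF assms]] vanishes_proj_point[OF assms(1)]
    vanishes_proj_point[OF assms(2)]
  by (simp add: poly_eval_mult)

lemma closedin_zero_locus: "S \<subseteq> hom_polys I \<Longrightarrow> closedin (zariski I) (zero_locus I S)"
  by (auto simp: closedin_zariski)

text \<open>Primality of the vanishing ideal: at each point one factor vanishes, so the zero loci of
  \<open>F\<close> and \<open>G\<close> are two closed sets covering \<open>Z\<close>.\<close>

lemma irreducible_vanishes_mult:
  assumes "irreducible_in (zariski I) Z" "F \<in> hom_polys I" "G \<in> hom_polys I" "vanishes Z (F * G)"
  shows "vanishes Z F \<or> vanishes Z G"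
proof -
  have Z: "Z \<subseteq> proj_space I" using assms(1) by (simp add: irreducible_in_def)
  have "Z \<subseteq> zero_locus I {F} \<union> zero_locus I {G}"
  proof
    fix L assume L: "L \<in> Z"
    then obtain p where p: "L = proj_point p" using Z by (auto simp: proj_space_def)
    have "vanishes {L} (F * G)" using assms(4) L vanishes_mono[of "{L}" Z] by blast
    then have "vanishes {L} F \<or> vanishes {L} G"
      unfolding p vanishes_mult_point[OF assms(2,3)] .
    then show "L \<in> zero_locus I {F} \<union> zero_locus I {G}"
      using L Z by (auto simp: zero_locus_def vanishes_def)
  qed
  then have "Z \<subseteq> zero_locus I {F} \<or> Z \<subseteq> zero_locus I {G}"
    using assms(1-3) closedin_zero_locus[of "{F}" I] closedin_zero_locus[of "{G}" I]
    by (simp add: irreducible_in_def)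
  then show ?thesis using subset_zero_locus_iff[OF Z] by auto
qed

lemma vanishes_closure:
  assumes "A \<subseteq> proj_space I" "F \<in> hom_polys I" "vanishes A F"
  shows "vanishes (zariski I closure_of A) F"
proof -
  have "A \<subseteq> zero_locus I {F}" using assms by (simp add: subset_zero_locus_iff)
  then have "zariski I closure_of A \<subseteq> zero_locus I {F}"
    using assms(2) by (intro closure_of_minimal closedin_zero_locus) auto
  then show ?thesis
    by (fastforce simp: zero_locus_def vanishes_def)
qed

text \<open>If two closed sets cover the closure but neither contains \<open>A\<close>, an equation
  of each can be chosen that does not vanish on \<open>A\<close>. Their product vanishes on
  \<open>A\<close>, contradicting \<open>prime\<close>.\<close>

lemma irreducible_closure:
  assumes A: "A \<subseteq> proj_space I" "A \<noteq> {}"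
    and prime: "\<And>F G. F \<in> hom_polys I \<Longrightarrow> G \<in> hom_polys I \<Longrightarrow> vanishes A (F * G) \<Longrightarrow>
      vanishes A F \<or> vanishes A G"
  shows "irreducible_in (zariski I) (zariski I closure_of A)"
  unfolding irreducible_in_def
proof (intro conjI allI impI)
  have sub: "A \<subseteq> zariski I closure_of A" using A by (intro closure_of_subset) simp
  then show "zariski I closure_of A \<noteq> {}" using A by blast
  show "zariski I closure_of A \<subseteq> topspace (zariski I)" by (rule closure_of_subset_topspace)
  fix B C assume BC: "closedin (zariski I) B \<and> closedin (zariski I) C \<and>
    zariski I closure_of A \<subseteq> B \<union> C"
  then obtain S S' where S: "S \<subseteq> hom_polys I" "B = zero_locus I S"
    and S': "S' \<subseteq> hom_polys I" "C = zero_locus I S'" by (auto simp: closedin_zariski)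
  have "A \<subseteq> B \<or> A \<subseteq> C"
  proof (rule ccontr)
    assume "\<not> (A \<subseteq> B \<or> A \<subseteq> C)"
    then obtain F G where FG: "F \<in> S" "\<not> vanishes A F" "G \<in> S'" "\<not> vanishes A G"
      using A S S' by (auto simp: subset_zero_locus_iff)
    have "vanishes A (F * G)"
      unfolding vanishes_def
    proof (intro ballI)
      fix L p assume L: "L \<in> A" "p \<in> L"
      then have "L \<in> zero_locus I S \<union> zero_locus I S'" using BC sub S S' by blast
      then show "poly_eval (Poly_Mapping.lookup p) (F * G) = 0"
        using L FG by (auto simp: zero_locus_def poly_eval_mult)
    qed
    then show False using prime[of F G] FG S(1) S'(1) by blast
  qed
  then show "zariski I closure_of A \<subseteq> B \<or> zariski I closure_of A \<subseteq> C"
    using BC closure_of_minimal[of A B "zariski I"] closure_of_minimal[of A C "zariski I"] by blast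
qed

section \<open>The Hilbert function along a chain of irreducible closed sets\<close>

text \<open>Lower bound \<open>h\<close> for the Hilbert function of \<open>Z\<close> in degree
  \<open>t\<close>, expressed by explicit forms instead of the dimension of a quotient
  space.\<close>

definition indep_forms :: "'i set \<Rightarrow> ('i \<Rightarrow>\<^sub>0 complex) set set \<Rightarrow> nat \<Rightarrow> nat \<Rightarrow> bool" where
  "indep_forms I Z t h \<longleftrightarrow> (\<exists>F :: nat \<Rightarrow> 'i cpoly. (\<forall>j<h. F j \<in> forms I t) \<and>
     (\<forall>c. vanishes Z (\<Sum>j<h. Poly_Mapping.single 0 (c j) * F j) \<longrightarrow> (\<forall>j<h. c j = 0)))"

lemma indep_forms_mono_set:
  assumes "Z \<subseteq> Z'" "indep_forms I Z t h"
  shows "indep_forms I Z' t h"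
proof -
  obtain F where "\<forall>j<h. F j \<in> forms I t"
    "\<forall>c. vanishes Z (\<Sum>j<h. Poly_Mapping.single 0 (c j) * F j) \<longrightarrow> (\<forall>j<h. c j = 0)"
    using assms(2) by (auto simp: indep_forms_def)
  then show ?thesis
    using vanishes_mono[OF assms(1)] unfolding indep_forms_def by (intro exI[of _ F]) simp
qed

lemma indep_forms_mono_card:
  assumes "h' \<le> h" "indep_forms I Z t h"
  shows "indep_forms I Z t h'"
proof -
  obtain F where F: "\<forall>j<h. F j \<in> forms I t"
    and ind: "\<And>c. vanishes Z (\<Sum>j<h. Poly_Mapping.single 0 (c j) * F j) \<Longrightarrow> \<forall>j<h. c j = 0"
    using assms by (auto simp: indep_forms_def)
  have "\<forall>j<h'. c j = 0" if v: "vanishes Z (\<Sum>j<h'. Poly_Mapping.single 0 (c j) * F j)" for c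
  proof -
    let ?c = "\<lambda>j. if j < h' then c j else 0"
    have "(\<Sum>j<h. Poly_Mapping.single 0 (?c j) * F j) = (\<Sum>j<h'. Poly_Mapping.single 0 (c j) * F j)"
      using assms(1) by (intro sum.mono_neutral_cong_right) auto
    then have "\<forall>j<h. ?c j = 0" using v ind[of ?c] by simp
    then show ?thesis using assms(1) by (metis less_le_trans)
  qed
  then show ?thesis using F assms(1) by (auto simp: indep_forms_def intro!: exI[of _ F])
qed

lemma sum_lessThan_add:
  "(\<Sum>j<h + k. f j) = (\<Sum>j<h. f j) + (\<Sum>j<k. f (h + j))" for f :: "nat \<Rightarrow> 'a::comm_monoid_add"
  by (induction k) (simp_all add: add.assoc)

text \<open>Restricting a relation to \<open>Z\<close> kills the multiples of \<open>f\<close>,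
  hence the first \<open>h\<close> coefficients are zero. What remains is \<open>f * B\<close>, and
  primality on \<open>Z'\<close> cancels \<open>f\<close>.\<close>

lemma indep_forms_step:
  assumes Z': "irreducible_in (zariski I) Z'" and sub: "Z \<subseteq> Z'"
    and f: "f \<in> forms I d" "vanishes Z f" "\<not> vanishes Z' f"
    and h: "indep_forms I Z (d + t) h" and h': "indep_forms I Z' t h'"
  shows "indep_forms I Z' (d + t) (h + h')"
proof -
  obtain F where F: "\<forall>j<h. F j \<in> forms I (d + t)"
    and indF: "\<And>c. vanishes Z (\<Sum>j<h. Poly_Mapping.single 0 (c j) * F j) \<Longrightarrow> \<forall>j<h. c j = 0"
    using h by (auto simp: indep_forms_def)
  obtain G where G: "\<forall>j<h'. G j \<in> forms I t"
    and indG: "\<And>c. vanishes Z' (\<Sum>j<h'. Poly_Mapping.single 0 (c j) * G j) \<Longrightarrow> \<forall>j<h'. c j = 0"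
    using h' by (auto simp: indep_forms_def)
  let ?H = "\<lambda>j. if j < h then F j else f * G (j - h)"
  have "?H j \<in> forms I (d + t)" if "j < h + h'" for j
    using that F G f(1) by (auto intro!: forms_mult)
  moreover have "\<forall>j<h + h'. c j = 0"
    if v: "vanishes Z' (\<Sum>j<h + h'. Poly_Mapping.single 0 (c j) * ?H j)" for c
  proof -
    define A where "A = (\<Sum>j<h. Poly_Mapping.single 0 (c j) * F j)"
    define B where "B = (\<Sum>j<h'. Poly_Mapping.single 0 (c (h + j)) * G j)"
    have split: "(\<Sum>j<h + h'. Poly_Mapping.single 0 (c j) * ?H j) = A + f * B"
      by (simp add: sum_lessThan_add A_def B_def sum_distrib_left algebra_simps)
    have "vanishes Z (A + f * B)" using v sub vanishes_mono unfolding split by blast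
    then have "vanishes Z A"
      using f(2) by (simp add: vanishes_def poly_eval_add poly_eval_mult)
    then have c1: "\<forall>j<h. c j = 0" unfolding A_def by (rule indF)
    then have "A = 0" by (simp add: A_def)
    then have "vanishes Z' (f * B)" using v unfolding split by simp
    moreover have "B \<in> forms I t"
      unfolding B_def using G by (intro forms_sum forms_smult) auto
    ultimately have "vanishes Z' B"
      using irreducible_vanishes_mult[OF Z', of f B] f forms_hom_polys by blast
    then have "\<forall>j<h'. c (h + j) = 0" unfolding B_def by (rule indG)
    show ?thesis
    proof (intro allI impI)
      fix j assume "j < h + h'"
      then show "c j = 0"
        using c1 \<open>\<forall>j<h'. c (h + j) = 0\<close> by (cases "j < h") (auto dest!: spec[of _ "j - h"])
    qed
  qed
  ultimately show ?thesis unfolding indep_forms_def by (intro exI[of _ ?H]) blast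
qed

text \<open>Some coordinate is nonzero at a point of \<open>Z\<close>, and its powers provide one
  independent form in every degree.\<close>

lemma indep_forms_nonempty:
  assumes "Z \<subseteq> proj_space I" "Z \<noteq> {}"
  shows "indep_forms I Z t 1"
proof -
  obtain p where p: "p \<noteq> 0" "Poly_Mapping.keys p \<subseteq> I" "proj_point p \<in> Z"
    using assms by (auto simp: proj_space_def)
  then obtain i where i: "Poly_Mapping.lookup p i \<noteq> 0" by (metis lookup_zero poly_mapping_eqI)
  then have "i \<in> I" using p(2) by (auto simp: in_keys_iff)
  have "pvar i ^ t \<in> forms I t" using forms_power[OF forms_pvar[OF \<open>i \<in> I\<close>], of t] by simp
  moreover have "c = 0" if "vanishes Z (Poly_Mapping.single 0 c * pvar i ^ t)" for c
  proof -
    have "poly_eval (Poly_Mapping.lookup p) (Poly_Mapping.single 0 c * pvar i ^ t) = 0"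
      using that p(3) proj_point_self by (auto simp: vanishes_def)
    then show ?thesis using i by (simp add: poly_eval_mult poly_eval_power)
  qed
  ultimately show ?thesis by (auto simp: indep_forms_def intro!: exI[of _ "\<lambda>_. pvar i ^ t"])
qed

lemma closed_strict_subset_form:
  assumes "closedin (zariski I) Z" "Z \<noteq> {}" "Z \<subset> Z'" "Z' \<subseteq> proj_space I"
  obtains f d where "d \<ge> 1" "f \<in> forms I d" "vanishes Z f" "\<not> vanishes Z' f"
proof -
  obtain S where S: "S \<subseteq> hom_polys I" "Z = zero_locus I S"
    using assms(1) by (auto simp: closedin_zariski)
  have "\<not> Z' \<subseteq> zero_locus I S" using assms(3) S by blast
  then obtain f where f: "f \<in> S" "\<not> vanishes Z' f"
    using subset_zero_locus_iff[OF assms(4)] by blast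
  have fZ: "vanishes Z f" using f S by (auto simp: vanishes_def zero_locus_def)
  obtain d where d: "f \<in> forms I d" using f S by (auto simp: hom_polys_forms)
  \<comment> \<open>A form of degree 0 has the same value everywhere, so vanishing on the nonempty
    \<open>Z\<close> would force it to vanish on \<open>Z'\<close>.\<close>
  have "d \<noteq> 0"
  proof
    assume "d = 0"
    have "mono_eval v \<mu> = 1" if "\<mu> \<in> Poly_Mapping.keys f" for v \<mu>
    proof -
      have "(\<Sum>i\<in>Poly_Mapping.keys \<mu>. Poly_Mapping.lookup \<mu> i) = 0"
        using that d \<open>d = 0\<close> by (auto simp: forms_def homogeneous_def mdeg_def)
      then show ?thesis by (auto simp: mono_eval_def)
    qed
    then have const: "poly_eval v f = poly_eval w f" for v w
      by (simp add: poly_eval_def)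
    obtain L where "L \<in> Z" using assms(2) by blast
    then have "L \<in> proj_space I" using assms(3,4) by blast
    then obtain p where "p \<in> L" using proj_point_self by (auto simp: proj_space_def)
    then have "poly_eval (Poly_Mapping.lookup p) f = 0"
      using fZ \<open>L \<in> Z\<close> by (auto simp: vanishes_def)
    then have "vanishes Z' f" using const by (metis vanishes_def)
    then show False using f by simp
  qed
  then show ?thesis using that[of d f] d fZ f by simp
qed

text \<open>The outer induction runs along the chain, the inner one over \<open>s\<close>. Each use
  of \<open>indep_forms_step\<close> in the inner induction is an instance of Pascal's rule. The
  scale \<open>D\<close> depends on the chain but not on \<open>s\<close>.\<close>

lemma indep_forms_chain:
  assumes "\<And>i. i \<le> k \<Longrightarrow> closedin (zariski I) (Z i) \<and> irreducible_in (zariski I) (Z i)"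
    and "\<And>i. i < k \<Longrightarrow> Z i \<subset> Z (Suc i)"
  shows "\<exists>D\<ge>1. \<forall>s. indep_forms I (Z k) (D * s) ((s + k) choose k)"
  using assms
proof (induction k)
  case 0
  then have "Z 0 \<subseteq> proj_space I" "Z 0 \<noteq> {}" by (auto simp: irreducible_in_def)
  then show ?case using indep_forms_nonempty[of "Z 0" I] by (intro exI[of _ 1]) simp
next
  case (Suc k)
  then obtain D where D: "D \<ge> 1" "\<And>s. indep_forms I (Z k) (D * s) ((s + k) choose k)" by auto
  have irr: "irreducible_in (zariski I) (Z (Suc k))" using Suc.prems by blast
  have sub: "Z k \<subset> Z (Suc k)" using Suc.prems by blast
  have "closedin (zariski I) (Z k)" "Z k \<noteq> {}" "Z (Suc k) \<subseteq> proj_space I"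
    using Suc.prems(1)[of k] irr by (auto simp: irreducible_in_def)
  then obtain f d where d: "d \<ge> 1" and f: "f \<in> forms I d" "vanishes (Z k) f" "\<not> vanishes (Z (Suc k)) f"
    using closed_strict_subset_form sub by metis
  \<comment> \<open>The power makes the degree a multiple of \<open>D\<close>, so that the
    hypothesis on \<open>Z k\<close> provides independent forms in exactly the degrees that the step
    needs.\<close>
  have fD: "f ^ D \<in> forms I (D * d)" using f(1) by (rule forms_power)
  have fDv: "vanishes (Z k) (f ^ D)" "\<not> vanishes (Z (Suc k)) (f ^ D)"
    using f(2,3) D(1) by (auto simp: vanishes_def poly_eval_power)
  have "indep_forms I (Z (Suc k)) (D * d * s) ((s + Suc k) choose Suc k)" for s
  proof (induction s)
    case 0
    then show ?case
      using indep_forms_nonempty[of "Z (Suc k)" I 0] irr by (auto simp: irreducible_in_def)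
  next
    case (Suc s)
    have "Suc s + k \<le> d * Suc s + k" using mult_le_mono1[OF d, of "Suc s"] by simp
    then have "(Suc s + k) choose k \<le> (d * Suc s + k) choose k" by (rule binomial_right_mono)
    then have "indep_forms I (Z k) (D * d + D * d * s) ((Suc s + k) choose k)"
      using indep_forms_mono_card D(2)[of "d * Suc s"] by (simp add: algebra_simps)
    from indep_forms_step[OF irr _ fD fDv this Suc.IH] sub show ?case
      by (simp add: algebra_simps)
  qed
  then show ?case using D(1) d by (intro exI[of _ "D * d"]) (simp add: one_le_mult_iff)
qed

section \<open>Parametrised sets: upper bound for the dimension\<close>

text \<open>Gaussian elimination by induction on the equations: a nonzero entry in row
  \<open>s\<close> eliminates the unknown \<open>k\<close> from the other rows, and
  \<open>ck\<close> is then solved from row \<open>s\<close>.\<close>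

lemma nontrivial_linear_relation:
  fixes A :: "'a \<Rightarrow> 'b \<Rightarrow> complex"
  assumes "finite S" "finite H" "card S < card H"
  shows "\<exists>c. (\<exists>j\<in>H. c j \<noteq> 0) \<and> (\<forall>s\<in>S. (\<Sum>j\<in>H. c j * A s j) = 0)"
  using assms
proof (induction S arbitrary: H A rule: finite_induct)
  case empty
  then obtain j where "j \<in> H" by (metis card_gt_0_iff card.empty ex_in_conv)
  then show ?case by (intro exI[of _ "\<lambda>_. 1"]) auto
next
  case (insert s S)
  show ?case
  proof (cases "\<forall>j\<in>H. A s j = 0")
    case True
    then show ?thesis using insert.IH[of H A] insert.prems insert.hyps by auto
  next
    case False
    then obtain k where k: "k \<in> H" "A s k \<noteq> 0" by blast
    define A' where "A' = (\<lambda>r j. A r j - A r k * A s j / A s k)"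
    have "card S < card (H - {k})" using insert.prems insert.hyps k by simp
    then obtain c where c: "\<exists>j\<in>H - {k}. c j \<noteq> 0"
      and c0: "\<And>r. r \<in> S \<Longrightarrow> (\<Sum>j\<in>H - {k}. c j * A' r j) = 0"
      using insert.IH[of "H - {k}" A'] insert.prems by auto
    define ck where "ck = - (\<Sum>j\<in>H - {k}. c j * A s j) / A s k"
    define c' where "c' = c(k := ck)"
    have sum_c': "(\<Sum>j\<in>H. c' j * A r j) = ck * A r k + (\<Sum>j\<in>H - {k}. c j * A r j)" for r
      using insert.prems k by (subst sum.remove[of H k]) (auto simp: c'_def intro!: sum.cong)
    have "(\<Sum>j\<in>H. c' j * A r j) = 0" if "r \<in> insert s S" for r
    proof (cases "r = s")
      case True
      then show ?thesis using k by (simp add: sum_c' ck_def)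
    next
      case False
      then have "(\<Sum>j\<in>H - {k}. c j * A' r j) = 0" using that c0 by blast
      moreover have "(\<Sum>j\<in>H - {k}. c j * A' r j) =
          (\<Sum>j\<in>H - {k}. c j * A r j) - A r k / A s k * (\<Sum>j\<in>H - {k}. c j * A s j)"
        by (simp add: A'_def sum_subtractf sum_distrib_left algebra_simps)
      ultimately show ?thesis by (simp add: sum_c' ck_def)
    qed
    moreover have "\<exists>j\<in>H. c' j \<noteq> 0" using c by (auto simp: c'_def)
    ultimately show ?thesis by blast
  qed
qed

section \<open>Polynomials of bounded degree in the parameters, and substitution\<close>

definition monomials_over :: "'j set \<Rightarrow> nat \<Rightarrow> ('j \<Rightarrow>\<^sub>0 nat) set" where
  "monomials_over J k = {\<mu>. Poly_Mapping.keys \<mu> \<subseteq> J \<and> mdeg \<mu> \<le> k}"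

definition bpolys :: "'j set \<Rightarrow> nat \<Rightarrow> 'j cpoly set" where
  "bpolys J k = {F. Poly_Mapping.keys F \<subseteq> monomials_over J k}"

lemma lookup_le_mdeg: "Poly_Mapping.lookup \<mu> i \<le> mdeg \<mu>"
proof (cases "i \<in> Poly_Mapping.keys \<mu>")
  case True
  then show ?thesis unfolding mdeg_def by (intro member_le_sum) auto
qed (simp add: in_keys_iff)

text \<open>Every exponent is at most \<open>k\<close>, so the exponent vectors embed into the
  functions from \<open>J\<close> to \<open>{..k}\<close>. This crude count already has the growth
  order in \<open>k\<close> required later.\<close>

lemma card_monomials_over:
  assumes "finite J"
  shows "finite (monomials_over J k)" "card (monomials_over J k) \<le> (k + 1) ^ card J"
proof -
  let ?f = "\<lambda>\<mu>. restrict (Poly_Mapping.lookup \<mu>) J"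
  have inj: "inj_on ?f (monomials_over J k)"
  proof (rule inj_onI)
    fix \<mu> \<nu> assume *: "\<mu> \<in> monomials_over J k" "\<nu> \<in> monomials_over J k" "?f \<mu> = ?f \<nu>"
    have "Poly_Mapping.lookup \<mu> i = Poly_Mapping.lookup \<nu> i" for i
    proof (cases "i \<in> J")
      case True
      then show ?thesis using fun_cong[OF *(3), of i] by simp
    next
      case False
      then have "i \<notin> Poly_Mapping.keys \<mu>" "i \<notin> Poly_Mapping.keys \<nu>"
        using * by (auto simp: monomials_over_def)
      then show ?thesis by (simp add: in_keys_iff)
    qed
    then show "\<mu> = \<nu>" by (rule poly_mapping_eqI)
  qed
  have sub: "?f ` monomials_over J k \<subseteq> J \<rightarrow>\<^sub>E {..k}"
    using order_trans[OF lookup_le_mdeg] by (auto simp: monomials_over_def)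
  have fin: "finite (J \<rightarrow>\<^sub>E {..k})" using assms by (intro finite_PiE) auto
  show "finite (monomials_over J k)" using inj sub fin by (meson finite_imageD finite_subset)
  show "card (monomials_over J k) \<le> (k + 1) ^ card J"
    using card_inj_on_le[OF inj sub fin] assms by (simp add: card_PiE)
qed

lemma bpolys_mono: "F \<in> bpolys J k \<Longrightarrow> k \<le> l \<Longrightarrow> F \<in> bpolys J l"
  by (auto simp: bpolys_def monomials_over_def)

lemma bpolys_add: "F \<in> bpolys J k \<Longrightarrow> G \<in> bpolys J k \<Longrightarrow> F + G \<in> bpolys J k"
  unfolding bpolys_def using Poly_Mapping.keys_add[of F G] by blast

lemma bpolys_0 [simp]: "0 \<in> bpolys J k"
  by (simp add: bpolys_def)

lemma bpolys_uminus: "F \<in> bpolys J k \<Longrightarrow> - F \<in> bpolys J k"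
  by (auto simp: bpolys_def in_keys_iff)

lemma bpolys_sum: "(\<And>a. a \<in> A \<Longrightarrow> f a \<in> bpolys J k) \<Longrightarrow> sum f A \<in> bpolys J k"
  by (induction A rule: infinite_finite_induct) (auto intro: bpolys_add)

lemma bpolys_mult:
  assumes "F \<in> bpolys J k" "G \<in> bpolys J l"
  shows "F * G \<in> bpolys J (k + l)"
proof -
  have "\<kappa> \<in> monomials_over J (k + l)" if \<kappa>: "\<kappa> \<in> Poly_Mapping.keys (F * G)" for \<kappa>
  proof -
    obtain \<mu> \<nu> where *: "\<mu> \<in> Poly_Mapping.keys F" "\<nu> \<in> Poly_Mapping.keys G" "\<kappa> = \<mu> + \<nu>"
      using \<kappa> keys_mult[of F G] by blast
    then have "\<mu> \<in> monomials_over J k" "\<nu> \<in> monomials_over J l" using assms by (auto simp: bpolys_def)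
    then show ?thesis
      using Poly_Mapping.keys_add[of \<mu> \<nu>] * by (auto simp: monomials_over_def mdeg_add)
  qed
  then show ?thesis by (auto simp: bpolys_def)
qed

lemma bpolys_const [simp]: "Poly_Mapping.single 0 c \<in> bpolys J k"
  by (simp add: bpolys_def monomials_over_def)

lemma bpolys_1 [simp]: "1 \<in> bpolys J k"
  using bpolys_const[of 1] by simp

lemma bpolys_pvar: "j \<in> J \<Longrightarrow> pvar j \<in> bpolys J 1"
  by (simp add: bpolys_def monomials_over_def pvar_def)

lemma bpolys_power: "F \<in> bpolys J k \<Longrightarrow> F ^ r \<in> bpolys J (r * k)"
  by (induction r) (auto dest: bpolys_mult)

lemma bpolys_prod:
  assumes "\<And>a. a \<in> A \<Longrightarrow> f a \<in> bpolys J (k a)"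
  shows "prod f A \<in> bpolys J (sum k A)"
  using assms by (induction A rule: infinite_finite_induct) (auto intro: bpolys_mult)

text \<open>The pullback of a form along the parametrisation, built as a polynomial so that its
  coefficients can enter a linear system.\<close>

definition psubst :: "('i \<Rightarrow> 'j cpoly) \<Rightarrow> 'i cpoly \<Rightarrow> 'j cpoly" where
  "psubst \<Phi> F = (\<Sum>\<mu>\<in>Poly_Mapping.keys F. Poly_Mapping.single 0 (Poly_Mapping.lookup F \<mu>) *
     (\<Prod>i\<in>Poly_Mapping.keys \<mu>. \<Phi> i ^ Poly_Mapping.lookup \<mu> i))"

lemma poly_eval_psubst: "poly_eval v (psubst \<Phi> F) = poly_eval (\<lambda>i. poly_eval v (\<Phi> i)) F"
  by (simp add: psubst_def poly_eval_sum poly_eval_mult poly_eval_prod poly_eval_power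
      poly_eval_def[of _ F] mono_eval_def)

lemma psubst_bpolys:
  assumes "F \<in> forms I t" "\<And>i. i \<in> I \<Longrightarrow> \<Phi> i \<in> bpolys J E"
  shows "psubst \<Phi> F \<in> bpolys J (E * t)"
  unfolding psubst_def
proof (rule bpolys_sum)
  fix \<mu> assume \<mu>: "\<mu> \<in> Poly_Mapping.keys F"
  have "(\<Prod>i\<in>Poly_Mapping.keys \<mu>. \<Phi> i ^ Poly_Mapping.lookup \<mu> i) \<in>
      bpolys J (\<Sum>i\<in>Poly_Mapping.keys \<mu>. Poly_Mapping.lookup \<mu> i * E)"
    using \<mu> assms by (intro bpolys_prod bpolys_power) (auto simp: forms_def)
  also have "(\<Sum>i\<in>Poly_Mapping.keys \<mu>. Poly_Mapping.lookup \<mu> i * E) = E * t"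
    using \<mu> assms(1) by (auto simp: forms_def homogeneous_def mdeg_def simp flip: sum_distrib_right)
  finally show "Poly_Mapping.single 0 (Poly_Mapping.lookup F \<mu>) *
      (\<Prod>i\<in>Poly_Mapping.keys \<mu>. \<Phi> i ^ Poly_Mapping.lookup \<mu> i) \<in> bpolys J (E * t)"
    using bpolys_mult[OF bpolys_const, where k = 0] by fastforce
qed

text \<open>Forms of degree \<open>t\<close> pull back to polynomials of degree at most
  \<open>E * t\<close> in \<open>card J\<close> variables. If there were more of them than
  monomials, some nontrivial combination would pull back to zero, hence vanish on \<open>X\<close>
  by \<open>dense\<close>.\<close>

lemma indep_forms_param_bound:
  fixes \<Phi> :: "'i \<Rightarrow> 'j cpoly"
  assumes J: "finite J" and \<Phi>: "\<And>i. i \<in> I \<Longrightarrow> \<Phi> i \<in> bpolys J E"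
    and dense: "\<And>F. F \<in> hom_polys I \<Longrightarrow>
      (\<And>v. poly_eval (\<lambda>i. poly_eval v (\<Phi> i)) F = 0) \<Longrightarrow> vanishes X F"
    and ind: "indep_forms I X t h"
  shows "h \<le> (E * t + 1) ^ card J"
proof (rule ccontr)
  assume "\<not> ?thesis"
  then have less: "card (monomials_over J (E * t)) < card {..<h}"
    using card_monomials_over(2)[OF J, of "E * t"] by simp
  obtain F where F: "\<forall>j<h. F j \<in> forms I t"
    and indF: "\<And>c. vanishes X (\<Sum>j<h. Poly_Mapping.single 0 (c j) * F j) \<Longrightarrow> \<forall>j<h. c j = 0"
    using ind by (auto simp: indep_forms_def)
  have bp: "psubst \<Phi> (F j) \<in> bpolys J (E * t)" if "j < h" for j
    using psubst_bpolys[of "F j" I t \<Phi> J E] F that \<Phi> by blast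
  obtain c where c: "\<exists>j\<in>{..<h}. c j \<noteq> 0"
    and c0: "\<And>\<mu>. \<mu> \<in> monomials_over J (E * t) \<Longrightarrow>
      (\<Sum>j<h. c j * Poly_Mapping.lookup (psubst \<Phi> (F j)) \<mu>) = 0"
    using nontrivial_linear_relation[OF card_monomials_over(1)[OF J] finite_lessThan less,
        of "\<lambda>\<mu> j. Poly_Mapping.lookup (psubst \<Phi> (F j)) \<mu>"] by blast
  let ?G = "\<Sum>j<h. Poly_Mapping.single 0 (c j) * F j"
  have "poly_eval (\<lambda>i. poly_eval v (\<Phi> i)) ?G = 0" for v
  proof -
    have "poly_eval (\<lambda>i. poly_eval v (\<Phi> i)) ?G = (\<Sum>j<h. c j * poly_eval v (psubst \<Phi> (F j)))"
      by (simp add: poly_eval_sum poly_eval_mult poly_eval_psubst)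
    also have "\<dots> = (\<Sum>j<h. c j * (\<Sum>\<mu>\<in>monomials_over J (E * t).
        Poly_Mapping.lookup (psubst \<Phi> (F j)) \<mu> * mono_eval v \<mu>))"
      using bp card_monomials_over(1)[OF J] by (intro sum.cong refl arg_cong2[of _ _ _ _ "(*)"]
          poly_eval_superset) (auto simp: bpolys_def)
    also have "\<dots> = (\<Sum>\<mu>\<in>monomials_over J (E * t).
        (\<Sum>j<h. c j * Poly_Mapping.lookup (psubst \<Phi> (F j)) \<mu>) * mono_eval v \<mu>)"
      by (simp add: sum_distrib_left sum_distrib_right mult.assoc sum.swap[of _ "{..<h}"])
    also have "\<dots> = 0" by (simp add: c0)
    finally show ?thesis .
  qed
  moreover have "?G \<in> hom_polys I"
    using F by (intro forms_hom_polys[of _ I t] forms_sum forms_smult) auto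
  ultimately have "vanishes X ?G" using dense by blast
  then show False using indF c by blast
qed

lemma binomial_exceeds_power:
  fixes M c :: nat
  assumes "M < k"
  shows "\<exists>s. (c * s + 1) ^ M < (s + k) choose k"
proof -
  \<comment> \<open>Since \<open>M < k\<close>, one spare power of \<open>s\<close> remains, and
    this \<open>s\<close> is large enough for it to absorb the constants \<open>k ^ k\<close> and
    \<open>(c + 1) ^ M\<close>.\<close>
  define s where "s = k ^ k * (c + 1) ^ M + 1"
  have k: "k > 0" using assms by simp
  have "(c * s + 1) ^ M \<le> ((c + 1) * s) ^ M" by (intro power_mono) (auto simp: s_def)
  moreover have "k ^ k * ((c + 1) * s) ^ M < s ^ k"
  proof -
    have "k ^ k * ((c + 1) * s) ^ M = (k ^ k * (c + 1) ^ M) * s ^ M"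
      by (simp only: power_mult_distrib mult.assoc)
    also have "\<dots> < s * s ^ M" by (intro mult_strict_right_mono) (auto simp: s_def)
    also have "\<dots> = s ^ Suc M" by simp
    also have "\<dots> \<le> s ^ k" using assms by (intro power_increasing) (auto simp: s_def)
    finally show ?thesis .
  qed
  ultimately have "k ^ k * (c * s + 1) ^ M < s ^ k"
    by (meson le_less_trans mult_le_mono2)
  then have "real (k ^ k * (c * s + 1) ^ M) < real (s ^ k)" by (simp only: of_nat_less_iff)
  then have "real ((c * s + 1) ^ M) < (real s / real k) ^ k"
    using k by (simp add: power_divide field_simps)
  also have "\<dots> \<le> (real (s + k) / real k) ^ k" by (intro power_mono divide_right_mono) auto
  also have "\<dots> \<le> real ((s + k) choose k)" using binomial_ge_n_over_k_pow_k[of k "s + k"] by simp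
  finally show ?thesis by (metis of_nat_less_iff)
qed

lemma irreducible_in_subtopologyD:
  assumes X: "closedin T X" and Z: "closedin (subtopology T X) Z" "irreducible_in (subtopology T X) Z"
  shows "closedin T Z \<and> irreducible_in T Z \<and> Z \<subseteq> X"
proof (intro conjI)
  show "closedin T Z" "Z \<subseteq> X" using X Z(1) by (auto simp: closedin_closed_subtopology)
  show "irreducible_in T Z"
    unfolding irreducible_in_def
  proof (intro conjI allI impI)
    show "Z \<subseteq> topspace T" "Z \<noteq> {}" using Z(2) by (auto simp: irreducible_in_def)
    fix A B assume AB: "closedin T A \<and> closedin T B \<and> Z \<subseteq> A \<union> B"
    then have "closedin (subtopology T X) (A \<inter> X)" "closedin (subtopology T X) (B \<inter> X)"
      using X by (auto simp: closedin_closed_subtopology)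
    moreover have "Z \<subseteq> (A \<inter> X) \<union> (B \<inter> X)" using AB \<open>Z \<subseteq> X\<close> by blast
    ultimately have "Z \<subseteq> A \<inter> X \<or> Z \<subseteq> B \<inter> X" using Z(2) unfolding irreducible_in_def by blast
    then show "Z \<subseteq> A \<or> Z \<subseteq> B" by blast
  qed
qed

lemma irreducible_in_subtopology:
  assumes "closedin T X" "irreducible_in T Z" "Z \<subseteq> X"
  shows "irreducible_in (subtopology T X) Z"
  using assms by (auto simp: irreducible_in_def closedin_closed_subtopology)

text \<open>A chain of length \<open>k\<close> gives \<open>(s + k) choose k\<close> independent
  forms in degree \<open>D * s\<close>, for every \<open>s\<close>. The parametrisation bounds this
  number by a polynomial in \<open>s\<close> of degree \<open>card J\<close>, so \<open>k\<close>
  cannot exceed \<open>card J\<close>.\<close>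

lemma dim_le_params:
  fixes \<Phi> :: "'i \<Rightarrow> 'j cpoly"
  assumes X: "closedin (zariski I) X"
    and J: "finite J" and \<Phi>: "\<And>i. i \<in> I \<Longrightarrow> \<Phi> i \<in> bpolys J E"
    and dense: "\<And>F. F \<in> hom_polys I \<Longrightarrow>
      (\<And>v. poly_eval (\<lambda>i. poly_eval v (\<Phi> i)) F = 0) \<Longrightarrow> vanishes X F"
  shows "dim_in (zariski I) X \<le> enat (card J)"
  unfolding dim_in_def krull_dim_def
proof (rule Sup_least, clarify)
  fix k and Z :: "nat \<Rightarrow> ('i \<Rightarrow>\<^sub>0 complex) set set"
  assume Z: "\<forall>i\<le>k. closedin (subtopology (zariski I) X) (Z i) \<and>
      irreducible_in (subtopology (zariski I) X) (Z i)" and strict: "\<forall>i<k. Z i \<subset> Z (Suc i)"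
  have Z': "closedin (zariski I) (Z i) \<and> irreducible_in (zariski I) (Z i) \<and> Z i \<subseteq> X"
    if "i \<le> k" for i
    using irreducible_in_subtopologyD[OF X] Z that by blast
  obtain D where D: "\<And>s. indep_forms I (Z k) (D * s) ((s + k) choose k)"
    using indep_forms_chain[of k I Z] Z' strict by blast
  have "(s + k) choose k \<le> (E * D * s + 1) ^ card J" for s
  proof -
    have "indep_forms I X (D * s) ((s + k) choose k)"
      using D Z'[of k] indep_forms_mono_set by blast
    then show ?thesis
      using indep_forms_param_bound[of J I \<Phi> E X "D * s"] J \<Phi> dense by (simp add: mult.assoc)
  qed
  then have "\<not> card J < k"
    using binomial_exceeds_power[of "card J" k "E * D"] by (metis not_less)
  then show "enat k \<le> enat (card J)" by simp
qed

section \<open>Parametrised sets: irreducibility and lower bound for the dimension\<close>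

definition polyfun :: "(complex \<Rightarrow> complex) \<Rightarrow> bool" where
  "polyfun f \<longleftrightarrow> (\<exists>q. \<forall>z. f z = poly q z)"

lemma polyfun_const [simp]: "polyfun (\<lambda>_. c)"
  by (auto simp: polyfun_def intro!: exI[of _ "[:c:]"])

lemma polyfun_affine: "polyfun (\<lambda>z. a + z * b)"
  by (auto simp: polyfun_def intro!: exI[of _ "[:a, b:]"])

lemma polyfun_add: "polyfun f \<Longrightarrow> polyfun g \<Longrightarrow> polyfun (\<lambda>z. f z + g z)"
  unfolding polyfun_def by (metis poly_add)

lemma polyfun_mult: "polyfun f \<Longrightarrow> polyfun g \<Longrightarrow> polyfun (\<lambda>z. f z * g z)"
  unfolding polyfun_def by (metis poly_mult)

lemma polyfun_sum: "(\<And>a. a \<in> A \<Longrightarrow> polyfun (f a)) \<Longrightarrow> polyfun (\<lambda>z. \<Sum>a\<in>A. f a z)"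
  by (induction A rule: infinite_finite_induct) (auto intro: polyfun_add)

lemma polyfun_prod: "(\<And>a. a \<in> A \<Longrightarrow> polyfun (f a)) \<Longrightarrow> polyfun (\<lambda>z. \<Prod>a\<in>A. f a z)"
  by (induction A rule: infinite_finite_induct) (auto intro: polyfun_mult)

lemma polyfun_power: "polyfun f \<Longrightarrow> polyfun (\<lambda>z. f z ^ k)"
  by (induction k) (auto intro: polyfun_mult)

lemma polyfun_poly_eval: "(\<And>i. polyfun (\<lambda>z. g z i)) \<Longrightarrow> polyfun (\<lambda>z. poly_eval (g z) F)"
  unfolding poly_eval_def mono_eval_def
  by (intro polyfun_sum polyfun_mult polyfun_const polyfun_prod polyfun_power)

lemma polyfun_mult_eq_0:
  assumes "polyfun f" "polyfun g" "\<And>z. f z * g z = 0"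
  shows "(\<forall>z. f z = 0) \<or> (\<forall>z. g z = 0)"
proof -
  obtain p q where pq: "\<And>z. f z = poly p z" "\<And>z. g z = poly q z"
    using assms by (auto simp: polyfun_def)
  then have "poly (p * q) z = 0" for z using assms(3) by simp
  then have "p * q = 0" by (metis poly_all_0_iff_0)
  then show ?thesis using pq by auto
qed

lemma polyfun_eq_0_punctured:
  assumes "polyfun f" "\<And>z. z \<noteq> c \<Longrightarrow> f z = 0"
  shows "f z = 0"
proof -
  \<comment> \<open>The second factor is \<open>z - c\<close>: its product with \<open>f\<close>
    vanishes everywhere, and it is not itself the zero function.\<close>
  have "(\<forall>z. f z = 0) \<or> (\<forall>z. - c + z * 1 = 0)"
    using assms by (intro polyfun_mult_eq_0 polyfun_affine) (auto simp: eq_neg_iff_add_eq_0)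
  then show ?thesis by (metis add_0 diff_add_cancel mult.right_neutral neg_eq_iff_add_eq_0 zero_neq_one)
qed

definition pm_of :: "'i set \<Rightarrow> ('i \<Rightarrow> complex) \<Rightarrow> ('i \<Rightarrow>\<^sub>0 complex)" where
  "pm_of I g = (\<Sum>i\<in>I. Poly_Mapping.single i (g i))"

lemma lookup_pm_of: "finite I \<Longrightarrow> Poly_Mapping.lookup (pm_of I g) i = (if i \<in> I then g i else 0)"
  by (auto simp: pm_of_def lookup_sum lookup_single when_def)

lemma keys_pm_of: "finite I \<Longrightarrow> Poly_Mapping.keys (pm_of I g) \<subseteq> I"
  by (auto simp: in_keys_iff lookup_pm_of split: if_splits)

lemma pm_of_lookup: "finite I \<Longrightarrow> Poly_Mapping.keys p \<subseteq> I \<Longrightarrow> pm_of I (Poly_Mapping.lookup p) = p"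
  by (rule poly_mapping_eqI) (auto simp: lookup_pm_of in_keys_iff)

lemma poly_eval_cong_forms:
  assumes "F \<in> hom_polys I" "\<And>i. i \<in> I \<Longrightarrow> v i = w i"
  shows "poly_eval v F = poly_eval w F"
proof -
  have "mono_eval v \<mu> = mono_eval w \<mu>" if "\<mu> \<in> Poly_Mapping.keys F" for \<mu>
  proof -
    have "Poly_Mapping.keys \<mu> \<subseteq> I" using assms(1) that by (auto simp: hom_polys_def)
    then show ?thesis using assms(2) unfolding mono_eval_def by (intro prod.cong) auto
  qed
  then show ?thesis by (simp add: poly_eval_def)
qed

lemma poly_eval_pm_of:
  assumes "finite I" "F \<in> hom_polys I"
  shows "poly_eval (Poly_Mapping.lookup (pm_of I g)) F = poly_eval g F"
  using assms by (intro poly_eval_cong_forms) (auto simp: lookup_pm_of)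

lemma pm_of_proj_space:
  assumes "finite I" "i \<in> I" "g i \<noteq> 0"
  shows "proj_point (pm_of I g) \<in> proj_space I"
proof -
  have "pm_of I g \<noteq> 0" using assms lookup_pm_of[of I g i] by auto
  then show ?thesis using keys_pm_of[OF assms(1)] by (auto simp: proj_space_def)
qed

text \<open>Any two points of an affine subspace of the parameter space lie on a line, along which
  forms become polynomials in one variable.\<close>

lemma param_irreducible:
  fixes \<Phi> :: "'i \<Rightarrow> 'j cpoly" and V :: "('j \<Rightarrow> complex) set" and I :: "'i set"
  defines "A \<equiv> (\<lambda>v. proj_point (pm_of I (\<lambda>i. poly_eval v (\<Phi> i)))) ` V"
  assumes I: "finite I" and A: "A \<subseteq> proj_space I" "V \<noteq> {}"
    and V: "\<And>v w z. v \<in> V \<Longrightarrow> w \<in> V \<Longrightarrow> (\<lambda>u. v u + z * (w u - v u)) \<in> V"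
  shows "irreducible_in (zariski I) (zariski I closure_of A)"
proof (rule irreducible_closure)
  fix F G assume FG: "F \<in> hom_polys I" "G \<in> hom_polys I" "vanishes A (F * G)"
  let ?e = "\<lambda>v F. poly_eval (\<lambda>i. poly_eval v (\<Phi> i)) F"
  have van: "vanishes A H \<longleftrightarrow> (\<forall>v\<in>V. ?e v H = 0)" if "H \<in> hom_polys I" for H
    unfolding A_def vanishes_image[OF that] poly_eval_pm_of[OF I that] ..
  have prod0: "?e v F * ?e v G = 0" if "v \<in> V" for v
    using FG that van[OF hom_polys_mult] by (simp add: poly_eval_mult)
  show "vanishes A F \<or> vanishes A G"
  proof (rule ccontr)
    assume "\<not> ?thesis"
    then obtain v w where vw: "v \<in> V" "w \<in> V" "?e v F \<noteq> 0" "?e w G \<noteq> 0" using van FG by blast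
    \<comment> \<open>The line with \<open>l 0 = v\<close>, where \<open>F\<close> does not vanish,
      and \<open>l 1 = w\<close>, where \<open>G\<close> does not vanish.\<close>
    define l where "l = (\<lambda>z u. v u + z * (w u - v u))"
    have pf: "polyfun (\<lambda>z. ?e (l z) H)" for H
      unfolding l_def by (intro polyfun_poly_eval polyfun_affine)
    have "(\<forall>z. ?e (l z) F = 0) \<or> (\<forall>z. ?e (l z) G = 0)"
    proof (rule polyfun_mult_eq_0[OF pf pf])
      show "?e (l z) F * ?e (l z) G = 0" for z
        using V[OF vw(1,2)] prod0 by (simp add: l_def)
    qed
    then have "?e (l 0) F = 0 \<or> ?e (l 1) G = 0" by blast
    then show False using vw by (simp add: l_def)
  qed
qed (use A in \<open>auto simp: A_def\<close>)

lemma dim_ge_chain: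
  assumes X: "closedin T X"
    and Z: "\<And>i. i \<le> k \<Longrightarrow> closedin T (Z i) \<and> irreducible_in T (Z i) \<and> Z i \<subseteq> X"
    and strict: "\<And>i. i < k \<Longrightarrow> Z i \<subset> Z (Suc i)"
  shows "enat k \<le> dim_in T X"
proof -
  have "\<forall>i\<le>k. closedin (subtopology T X) (Z i) \<and> irreducible_in (subtopology T X) (Z i)"
    using X Z irreducible_in_subtopology[OF X] by (simp add: closedin_closed_subtopology)
  then show ?thesis
    unfolding dim_in_def krull_dim_def using strict by (intro Sup_upper) blast
qed

text \<open>Each entry of \<open>us\<close> consists of a parameter and a form. The closed set
  \<open>Z i\<close> comes from the parameter points that agree with \<open>v\<^sub>0\<close> except
  in the first \<open>i\<close> listed parameters. The form of entry \<open>i\<close> vanishes on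
  it, but no longer does once the parameter of that entry is freed, so the chain is strict.\<close>

lemma dim_ge_params:
  fixes \<Phi> :: "'i \<Rightarrow> 'j cpoly" and us :: "('j \<times> 'i cpoly) list"
  assumes I: "finite I" and X: "closedin (zariski I) X"
    and in_X: "\<And>v. proj_point (pm_of I (\<lambda>i. poly_eval v (\<Phi> i))) \<in> X"
    and forms: "\<And>f. f \<in> snd ` set us \<Longrightarrow> f \<in> hom_polys I"
    and zero: "\<And>i v. i < length us \<Longrightarrow> (\<And>u. u \<notin> fst ` set (take i us) \<Longrightarrow> v u = v\<^sub>0 u) \<Longrightarrow>
      poly_eval (\<lambda>i. poly_eval v (\<Phi> i)) (snd (us ! i)) = 0"
    and nonzero: "\<And>i. i < length us \<Longrightarrow>
      \<exists>c. poly_eval (\<lambda>j. poly_eval (v\<^sub>0(fst (us ! i) := c)) (\<Phi> j)) (snd (us ! i)) \<noteq> 0"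
  shows "enat (length us) \<le> dim_in (zariski I) X"
proof -
  define V where "V = (\<lambda>i. {v. \<forall>u. u \<notin> fst ` set (take i us) \<longrightarrow> v u = v\<^sub>0 u})"
  define A where "A = (\<lambda>i. (\<lambda>v. proj_point (pm_of I (\<lambda>i. poly_eval v (\<Phi> i)))) ` V i)"
  define Z where "Z = (\<lambda>i. zariski I closure_of (A i))"
  have XP: "X \<subseteq> proj_space I" using X closedin_subset by fastforce
  have AX: "A i \<subseteq> X" for i using in_X by (auto simp: A_def)
  have AP: "A i \<subseteq> proj_space I" for i using AX XP by blast
  have ZP: "Z i \<subseteq> proj_space I" for i
    unfolding Z_def using closure_of_subset_topspace[of "zariski I"] by simp
  have AZ: "A i \<subseteq> Z i" for i unfolding Z_def using AP by (intro closure_of_subset) simp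
  show ?thesis
  proof (rule dim_ge_chain[OF X])
    fix i
    show "closedin (zariski I) (Z i) \<and> irreducible_in (zariski I) (Z i) \<and> Z i \<subseteq> X"
    proof (intro conjI)
      show "closedin (zariski I) (Z i)" by (simp add: Z_def)
      show "Z i \<subseteq> X" unfolding Z_def using AX X by (rule closure_of_minimal)
      have "v\<^sub>0 \<in> V i" by (simp add: V_def)
      then show "irreducible_in (zariski I) (Z i)"
        using AP[of i] unfolding Z_def A_def
        by (intro param_irreducible I) (auto simp: V_def)
    qed
  next
    fix i assume i: "i < length us"
    have take: "take (Suc i) us = take i us @ [us ! i]" using i by (rule take_Suc_conv_app_nth)
    have hom: "snd (us ! i) \<in> hom_polys I" using i by (intro forms) simp
    have van: "vanishes (A j) (snd (us ! i)) \<longleftrightarrow>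
        (\<forall>v\<in>V j. poly_eval (\<lambda>i. poly_eval v (\<Phi> i)) (snd (us ! i)) = 0)" for j
      unfolding A_def vanishes_image[OF hom] poly_eval_pm_of[OF I hom] ..
    have "vanishes (A i) (snd (us ! i))" unfolding van using zero[OF i] by (simp add: V_def)
    then have "vanishes (Z i) (snd (us ! i))" unfolding Z_def by (rule vanishes_closure[OF AP hom])
    moreover have "\<not> vanishes (A (Suc i)) (snd (us ! i))"
    proof -
      obtain c where c: "poly_eval (\<lambda>j. poly_eval (v\<^sub>0(fst (us ! i) := c)) (\<Phi> j)) (snd (us ! i)) \<noteq> 0"
        using nonzero[OF i] by blast
      have "v\<^sub>0(fst (us ! i) := c) \<in> V (Suc i)" by (auto simp: V_def take)
      then show ?thesis using c van by blast
    qed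
    then have "\<not> vanishes (Z (Suc i)) (snd (us ! i))" using AZ vanishes_mono by blast
    moreover have "V i \<subseteq> V (Suc i)" by (auto simp: V_def take)
    then have "A i \<subseteq> A (Suc i)" by (auto simp: A_def)
    then have "Z i \<subseteq> Z (Suc i)" unfolding Z_def by (rule closure_of_mono)
    ultimately show "Z i \<subset> Z (Suc i)" by (auto simp: psubset_eq)
  qed
qed

section \<open>The dimension of projective space\<close>

text \<open>Scaling covers all points whose coordinate \<open>i\<^sub>0\<close> is nonzero. The
  others follow by regarding the value as a polynomial in that coordinate alone.\<close>

lemma vanishes_affine_chart:
  assumes I: "finite I" and i\<^sub>0: "i\<^sub>0 \<in> I" and F: "F \<in> hom_polys I"
    and chart: "\<And>v. v i\<^sub>0 = 1 \<Longrightarrow> poly_eval v F = 0"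
  shows "poly_eval v F = 0"
proof -
  have nz: "poly_eval w F = 0" if "w i\<^sub>0 \<noteq> 0" for w
  proof -
    let ?w = "\<lambda>i. w i / w i\<^sub>0"
    have "pm_of I ?w \<in> proj_point (pm_of I w)"
      unfolding proj_point_def using that I
      by (auto intro!: exI[of _ "1 / w i\<^sub>0"] poly_mapping_eqI simp: map.rep_eq when_def lookup_pm_of)
    moreover obtain k where "homogeneous k F" using F by (auto simp: hom_polys_def)
    ultimately have "poly_eval ?w F = 0 \<longleftrightarrow> poly_eval w F = 0"
      using poly_eval_proj_point[of k F "pm_of I ?w" "pm_of I w"]
      by (simp add: poly_eval_pm_of[OF I F])
    then show ?thesis using chart[of ?w] that by simp
  qed
  have "poly_eval (v(i\<^sub>0 := v i\<^sub>0)) F = 0"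
  proof (rule polyfun_eq_0_punctured[of "\<lambda>z. poly_eval (v(i\<^sub>0 := z)) F" 0])
    show "polyfun (\<lambda>z. poly_eval (v(i\<^sub>0 := z)) F)"
    proof (rule polyfun_poly_eval)
      fix i show "polyfun (\<lambda>z. (v(i\<^sub>0 := z)) i)" using polyfun_affine[of 0 1] by (cases "i = i\<^sub>0") auto
    qed
  qed (use nz in simp)
  then show ?thesis by simp
qed

lemma krull_dim_eq_dim_in: "krull_dim T = dim_in T (topspace T)"
  by (simp add: dim_in_def)

theorem krull_dim_proj_space:
  assumes I: "finite I" and i\<^sub>0: "i\<^sub>0 \<in> I"
  shows "krull_dim (zariski I) = enat (card I - 1)"
proof -
  \<comment> \<open>The affine chart where coordinate \<open>i\<^sub>0\<close> equals 1. It is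
    dense, and its coordinate functions also separate the members of the chain for the lower
    bound.\<close>
  define \<Phi> :: "'a \<Rightarrow> 'a cpoly" where "\<Phi> = (\<lambda>i. if i = i\<^sub>0 then 1 else pvar i)"
  have ev: "poly_eval v (\<Phi> i) = (v(i\<^sub>0 := 1)) i" for v i by (simp add: \<Phi>_def)
  have closed: "closedin (zariski I) (proj_space I)"
    using closedin_topspace[of "zariski I"] by simp
  have card: "card (I - {i\<^sub>0}) = card I - 1" using assms by simp
  have "dim_in (zariski I) (proj_space I) \<le> enat (card (I - {i\<^sub>0}))"
  proof (rule dim_le_params[OF closed, where \<Phi> = \<Phi> and E = 1])
    show "\<Phi> i \<in> bpolys (I - {i\<^sub>0}) 1" if "i \<in> I" for i
      using that by (auto simp: \<Phi>_def intro: bpolys_pvar[unfolded One_nat_def])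
    fix F assume F: "F \<in> hom_polys I" and z: "\<And>v. poly_eval (\<lambda>i. poly_eval v (\<Phi> i)) F = 0"
    have "poly_eval v F = 0" for v
    proof (rule vanishes_affine_chart[OF I i\<^sub>0 F])
      fix v :: "'a \<Rightarrow> complex" assume "v i\<^sub>0 = 1"
      then show "poly_eval v F = 0" using z[of v] unfolding ev by (simp add: fun_upd_idem)
    qed
    then show "vanishes (proj_space I) F" by (simp add: vanishes_def)
  qed (use I in simp)
  moreover obtain xs where xs: "set xs = I - {i\<^sub>0}" "distinct xs"
    using finite_distinct_list[of "I - {i\<^sub>0}"] I by blast
  let ?us = "map (\<lambda>i. (i, pvar i)) xs"
  have "enat (length ?us) \<le> dim_in (zariski I) (proj_space I)"
  proof (rule dim_ge_params[OF I closed, where \<Phi> = \<Phi> and v\<^sub>0 = "\<lambda>_. 0"])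
    show "proj_point (pm_of I (\<lambda>i. poly_eval v (\<Phi> i))) \<in> proj_space I" for v
      using I i\<^sub>0 by (intro pm_of_proj_space[of I i\<^sub>0]) (auto simp: ev)
    show "f \<in> hom_polys I" if f: "f \<in> snd ` set ?us" for f
    proof -
      obtain i where "f = pvar i" "i \<in> set xs" using f by auto
      then show ?thesis using xs(1) forms_hom_polys[OF forms_pvar[of i I]] by simp
    qed
    fix i assume "i < length ?us"
    then have i: "i < length xs" by simp
    then have xi: "xs ! i \<noteq> i\<^sub>0" using xs(1) nth_mem by blast
    show "\<exists>c. poly_eval (\<lambda>j. poly_eval ((\<lambda>_. 0)(fst (?us ! i) := c)) (\<Phi> j)) (snd (?us ! i)) \<noteq> 0"
      using i xi by (intro exI[of _ 1]) (simp add: ev)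
    fix v :: "'a \<Rightarrow> complex" assume v: "\<And>u. u \<notin> fst ` set (take i ?us) \<Longrightarrow> v u = 0"
    have "xs ! i \<notin> set (take i xs)"
      using i xs(2) by (auto simp: in_set_conv_nth nth_eq_iff_index_eq)
    then have "v (xs ! i) = 0" by (intro v) (auto simp: take_map)
    then show "poly_eval (\<lambda>i. poly_eval v (\<Phi> i)) (snd (?us ! i)) = 0"
      using i xi by (simp add: ev)
  qed
  moreover have "length xs = card I - 1" using xs card distinct_card by fastforce
  ultimately show ?thesis using card by (simp add: krull_dim_eq_dim_in)
qed

section \<open>Taylor polynomials of rational functions, algebraically\<close>

text \<open>The formal partial derivative. Truncated subtraction of exponents is harmless: where it
  would truncate, the coefficient contains the factor 0.\<close>

definition pd :: "'i \<Rightarrow> 'i cpoly \<Rightarrow> 'i cpoly" where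
  "pd i F = (\<Sum>\<mu>\<in>Poly_Mapping.keys F.
     Poly_Mapping.single (\<mu> - Poly_Mapping.single i 1) (Poly_Mapping.lookup F \<mu> * of_nat (Poly_Mapping.lookup \<mu> i)))"

lemma mono_eval_fun_upd:
  "mono_eval (x(i := t)) \<mu> = t ^ Poly_Mapping.lookup \<mu> i *
     (\<Prod>j\<in>Poly_Mapping.keys \<mu> - {i}. x j ^ Poly_Mapping.lookup \<mu> j)"
proof -
  have "mono_eval (x(i := t)) \<mu> = (\<Prod>j\<in>insert i (Poly_Mapping.keys \<mu> - {i}).
      (x(i := t)) j ^ Poly_Mapping.lookup \<mu> j)"
    by (rule mono_eval_superset) auto
  also have "\<dots> = t ^ Poly_Mapping.lookup \<mu> i *
      (\<Prod>j\<in>Poly_Mapping.keys \<mu> - {i}. x j ^ Poly_Mapping.lookup \<mu> j)"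
    by (subst prod.insert) (auto intro!: prod.cong)
  finally show ?thesis .
qed

lemma mono_eval_has_deriv:
  "((\<lambda>t. mono_eval (x(i := t)) \<mu>) has_field_derivative
     of_nat (Poly_Mapping.lookup \<mu> i) * mono_eval (x(i := t)) (\<mu> - Poly_Mapping.single i 1)) (at t)"
proof -
  let ?C = "\<Prod>j\<in>Poly_Mapping.keys \<mu> - {i}. x j ^ Poly_Mapping.lookup \<mu> j"
  let ?r = "Poly_Mapping.lookup \<mu> i"
  have "(\<Prod>j\<in>Poly_Mapping.keys (\<mu> - Poly_Mapping.single i 1) - {i}.
      x j ^ Poly_Mapping.lookup (\<mu> - Poly_Mapping.single i 1) j) = ?C"
    by (rule prod.cong) (auto simp: in_keys_iff lookup_minus lookup_single when_def)
  then have "mono_eval (x(i := t)) (\<mu> - Poly_Mapping.single i 1) = t ^ (?r - 1) * ?C"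
    by (simp add: mono_eval_fun_upd lookup_minus)
  moreover have "((\<lambda>t. t ^ ?r * ?C) has_field_derivative (of_nat ?r * t ^ (?r - 1)) * ?C) (at t)"
    by (intro derivative_eq_intros) auto
  ultimately show ?thesis by (simp add: mono_eval_fun_upd mult.assoc)
qed

lemma poly_eval_has_deriv:
  "((\<lambda>t. poly_eval (x(i := t)) F) has_field_derivative poly_eval (x(i := t)) (pd i F)) (at t)"
proof -
  have "((\<lambda>t. \<Sum>\<mu>\<in>Poly_Mapping.keys F. Poly_Mapping.lookup F \<mu> * mono_eval (x(i := t)) \<mu>)
    has_field_derivative (\<Sum>\<mu>\<in>Poly_Mapping.keys F. Poly_Mapping.lookup F \<mu> *
      (of_nat (Poly_Mapping.lookup \<mu> i) * mono_eval (x(i := t)) (\<mu> - Poly_Mapping.single i 1)))) (at t)"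
    by (intro DERIV_sum DERIV_cmult mono_eval_has_deriv)
  then show ?thesis
    by (simp add: poly_eval_def[of _ F] pd_def poly_eval_sum poly_eval_single mult.assoc)
qed

lemma add_single_eq_iff:
  fixes \<mu> \<nu> :: "'i \<Rightarrow>\<^sub>0 nat"
  assumes "Poly_Mapping.lookup \<mu> i \<noteq> 0"
  shows "\<mu> - Poly_Mapping.single i 1 = \<nu> \<longleftrightarrow> \<mu> = \<nu> + Poly_Mapping.single i 1"
proof -
  have "\<mu> - Poly_Mapping.single i 1 + Poly_Mapping.single i 1 = \<mu>"
    using assms by (intro poly_mapping_eqI) (auto simp: lookup_add lookup_minus lookup_single when_def)
  then show ?thesis by auto
qed

lemma lookup_pd:
  "Poly_Mapping.lookup (pd i F) \<nu> = of_nat (Suc (Poly_Mapping.lookup \<nu> i)) *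
     Poly_Mapping.lookup F (\<nu> + Poly_Mapping.single i 1)"
proof -
  let ?\<mu> = "\<nu> + Poly_Mapping.single i 1"
  have "Poly_Mapping.lookup (pd i F) \<nu> = (\<Sum>\<mu>\<in>Poly_Mapping.keys F.
      if \<mu> = ?\<mu> then Poly_Mapping.lookup F \<mu> * of_nat (Poly_Mapping.lookup \<mu> i) else 0)"
    unfolding pd_def lookup_sum
  proof (rule sum.cong[OF refl])
    fix \<mu>
    show "Poly_Mapping.lookup (Poly_Mapping.single (\<mu> - Poly_Mapping.single i 1)
        (Poly_Mapping.lookup F \<mu> * of_nat (Poly_Mapping.lookup \<mu> i))) \<nu> =
        (if \<mu> = ?\<mu> then Poly_Mapping.lookup F \<mu> * of_nat (Poly_Mapping.lookup \<mu> i) else 0)"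
      using add_single_eq_iff[of \<mu> i \<nu>]
      by (cases "Poly_Mapping.lookup \<mu> i = 0") (auto simp: lookup_single when_def)
  qed
  also have "\<dots> = Poly_Mapping.lookup F ?\<mu> * of_nat (Poly_Mapping.lookup ?\<mu> i)"
    by (auto simp: in_keys_iff)
  finally show ?thesis by (simp add: lookup_add mult.commute)
qed

section \<open>Order of vanishing at the origin\<close>

definition ord_ge :: "nat \<Rightarrow> 'i cpoly \<Rightarrow> bool" where
  "ord_ge k F \<longleftrightarrow> (\<forall>\<mu>\<in>Poly_Mapping.keys F. k \<le> mdeg \<mu>)"

lemma ord_ge_0 [simp]: "ord_ge 0 F"
  by (simp add: ord_ge_def)

lemma ord_ge_mono: "ord_ge k F \<Longrightarrow> l \<le> k \<Longrightarrow> ord_ge l F"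
  by (auto simp: ord_ge_def)

lemma ord_ge_add: "ord_ge k F \<Longrightarrow> ord_ge k G \<Longrightarrow> ord_ge k (F + G)"
  unfolding ord_ge_def using Poly_Mapping.keys_add[of F G] by blast

lemma ord_ge_uminus: "ord_ge k F \<Longrightarrow> ord_ge k (- F)"
  by (auto simp: ord_ge_def in_keys_iff)

lemma ord_ge_diff: "ord_ge k F \<Longrightarrow> ord_ge k G \<Longrightarrow> ord_ge k (F - G)"
  using ord_ge_add[OF _ ord_ge_uminus, of k F G] by simp

lemma ord_ge_mult:
  assumes "ord_ge k F" "ord_ge l G"
  shows "ord_ge (k + l) (F * G)"
  unfolding ord_ge_def
proof
  fix \<kappa> assume "\<kappa> \<in> Poly_Mapping.keys (F * G)"
  then obtain \<mu> \<nu> where "\<mu> \<in> Poly_Mapping.keys F" "\<nu> \<in> Poly_Mapping.keys G" "\<kappa> = \<mu> + \<nu>"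
    using keys_mult[of F G] by blast
  then show "k + l \<le> mdeg \<kappa>" using assms by (auto simp: ord_ge_def mdeg_add intro: add_mono)
qed

lemma ord_ge_power: "ord_ge 1 F \<Longrightarrow> ord_ge k (F ^ k)"
  by (induction k) (auto dest: ord_ge_mult)

lemma ord_ge_pd:
  assumes "ord_ge k F"
  shows "ord_ge (k - 1) (pd i F)"
  unfolding ord_ge_def
proof
  fix \<nu> assume "\<nu> \<in> Poly_Mapping.keys (pd i F)"
  then have "\<nu> + Poly_Mapping.single i 1 \<in> Poly_Mapping.keys F"
    by (auto simp: in_keys_iff lookup_pd)
  then have "k \<le> mdeg (\<nu> + Poly_Mapping.single i 1)" using assms by (simp add: ord_ge_def)
  then show "k - 1 \<le> mdeg \<nu>" by (simp add: mdeg_add)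
qed

lemma mono_eval_at_0: "mono_eval (\<lambda>_. 0) \<mu> = (if \<mu> = 0 then 1 else 0)"
proof (cases "\<mu> = 0")
  case False
  then obtain i where "i \<in> Poly_Mapping.keys \<mu>"
    by (metis in_keys_iff lookup_zero poly_mapping_eqI)
  then have "\<exists>i\<in>Poly_Mapping.keys \<mu>. (0::complex) ^ Poly_Mapping.lookup \<mu> i = 0"
    by (auto simp: in_keys_iff)
  then show ?thesis using False by (auto simp: mono_eval_def)
qed simp

lemma poly_eval_at_0: "poly_eval (\<lambda>_. 0) F = Poly_Mapping.lookup F 0"
  by (auto simp: poly_eval_def mono_eval_at_0 in_keys_iff if_distrib cong: if_cong)

lemma mdeg_eq_0_iff: "mdeg \<mu> = 0 \<longleftrightarrow> \<mu> = 0"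
proof
  assume "mdeg \<mu> = 0"
  then have "Poly_Mapping.lookup \<mu> i = 0" for i using lookup_le_mdeg[of \<mu> i] by simp
  then show "\<mu> = 0" by (intro poly_mapping_eqI) simp
qed simp

lemma ord_ge_1_iff: "ord_ge 1 F \<longleftrightarrow> poly_eval (\<lambda>_. 0) F = 0"
proof -
  have "ord_ge 1 F \<longleftrightarrow> 0 \<notin> Poly_Mapping.keys F"
    unfolding ord_ge_def using mdeg_eq_0_iff by (metis less_one not_less)
  then show ?thesis unfolding poly_eval_at_0 by (simp add: in_keys_iff)
qed

text \<open>The derivatives of \<open>T + R / Q\<^sup>k\<close> are again of this shape, and each of them lowers the order of
  the error term by at most one; only values where \<open>Q\<close> does not vanish matter.\<close>

definition rat_approx :: "'i cpoly \<Rightarrow> (('i \<Rightarrow> complex) \<Rightarrow> complex) \<Rightarrow> 'i cpoly \<Rightarrow> nat \<Rightarrow> bool" where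
  "rat_approx Q g T j \<longleftrightarrow> (\<exists>R k. ord_ge j R \<and> (\<forall>x. poly_eval x Q \<noteq> 0 \<longrightarrow>
     g x = poly_eval x T + poly_eval x R / poly_eval x Q ^ k))"

lemma rat_approx_partial_deriv:
  assumes "rat_approx Q g T j"
  shows "rat_approx Q (partial_deriv i g) (pd i T) (j - 1)"
proof -
  obtain R k where R: "ord_ge j R" and g: "\<And>x. poly_eval x Q \<noteq> 0 \<Longrightarrow>
      g x = poly_eval x T + poly_eval x R / poly_eval x Q ^ k"
    using assms by (auto simp: rat_approx_def)
  \<comment> \<open>The numerator that the quotient rule gives for \<open>R / Q ^ k\<close> over the
    denominator \<open>Q ^ (k + 1)\<close>.\<close>
  let ?R = "pd i R * Q - Poly_Mapping.single 0 (of_nat k) * (R * pd i Q)"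
  have "ord_ge (j - 1) ?R"
    using ord_ge_mult[OF ord_ge_pd[OF R, of i] ord_ge_0[of Q]]
      ord_ge_mult[OF ord_ge_0 ord_ge_mult[OF ord_ge_mono[OF R, of "j - 1"] ord_ge_0]]
    by (intro ord_ge_diff) auto
  moreover have "partial_deriv i g x = poly_eval x (pd i T) + poly_eval x ?R / poly_eval x Q ^ (k + 1)"
    if x: "poly_eval x Q \<noteq> 0" for x
  proof -
    let ?e = "\<lambda>F t. poly_eval (x(i := t)) F"
    have der: "((\<lambda>t. ?e F t) has_field_derivative poly_eval x (pd i F)) (at (x i))" for F
      using poly_eval_has_deriv[of x i F "x i"] by simp
    have "((\<lambda>t. ?e T t + ?e R t / ?e Q t ^ k) has_field_derivative
        (poly_eval x (pd i T) + (poly_eval x (pd i R) * ?e Q (x i) ^ k -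
          ?e R (x i) * (of_nat k * (poly_eval x (pd i Q) * ?e Q (x i) ^ (k - Suc 0)))) /
          (?e Q (x i) ^ k * ?e Q (x i) ^ k))) (at (x i))"
      using x by (intro DERIV_add der DERIV_divide DERIV_power) auto
    also have "(poly_eval x (pd i R) * ?e Q (x i) ^ k -
          ?e R (x i) * (of_nat k * (poly_eval x (pd i Q) * ?e Q (x i) ^ (k - Suc 0)))) /
          (?e Q (x i) ^ k * ?e Q (x i) ^ k) = poly_eval x ?R / poly_eval x Q ^ (k + 1)"
      using x by (cases k) (simp_all add: poly_eval_diff poly_eval_mult divide_simps, simp add: algebra_simps)
    finally have d: "((\<lambda>t. ?e T t + ?e R t / ?e Q t ^ k) has_field_derivative
        (poly_eval x (pd i T) + poly_eval x ?R / poly_eval x Q ^ (k + 1))) (at (x i))" .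
    \<comment> \<open>The formula for \<open>g\<close> is known only where \<open>Q\<close> is
      nonzero. By continuity this holds for all \<open>t\<close> near \<open>x i\<close>, which
      suffices for the derivative.\<close>
    have "isCont (?e Q) (x i)" using der DERIV_isCont by blast
    then have "(?e Q \<longlongrightarrow> ?e Q (x i)) (nhds (x i))"
      unfolding isCont_def by (rule iffD1[OF tendsto_at_iff_tendsto_nhds[of "?e Q" "x i"]])
    then have "\<forall>\<^sub>F t in nhds (x i). ?e Q t \<noteq> 0"
      using x by (intro tendsto_imp_eventually_ne) auto
    then have "\<forall>\<^sub>F t in nhds (x i). g (x(i := t)) = ?e T t + ?e R t / ?e Q t ^ k"
      by eventually_elim (rule g)
    then have "deriv (\<lambda>t. g (x(i := t))) (x i) = deriv (\<lambda>t. ?e T t + ?e R t / ?e Q t ^ k) (x i)"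
      by (rule deriv_cong_ev) simp
    then show ?thesis unfolding partial_deriv_def using DERIV_imp_deriv[OF d] by simp
  qed
  ultimately show ?thesis unfolding rat_approx_def by blast
qed

lemma rat_approx_funpow:
  "rat_approx Q g T j \<Longrightarrow> rat_approx Q ((partial_deriv i ^^ r) g) ((pd i ^^ r) T) (j - r)"
proof (induction r)
  case (Suc r)
  then show ?case using rat_approx_partial_deriv[of Q _ _ "j - r" i] by simp
qed simp

lemma rat_approx_foldr:
  assumes "rat_approx Q g T j"
  shows "rat_approx Q (foldr (\<lambda>i D. (partial_deriv i ^^ a i) \<circ> D) is id g)
    (foldr (\<lambda>i D. (pd i ^^ a i) \<circ> D) is id T) (j - sum_list (map a is))"
proof (induction "is")
  case (Cons i "is")
  have "j - sum_list (map a (i # is)) = j - sum_list (map a is) - a i" by simp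
  then show ?case using rat_approx_funpow[OF Cons.IH, of "a i" i] by simp
qed (use assms in simp)

text \<open>Repeated differentiation multiplies by a quotient of factorials; its denominator is
  moved to the left.\<close>

lemma lookup_funpow_pd:
  "fact (Poly_Mapping.lookup \<mu> i) * Poly_Mapping.lookup ((pd i ^^ r) T) \<mu> =
    fact (Poly_Mapping.lookup \<mu> i + r) * Poly_Mapping.lookup T (\<mu> + Poly_Mapping.single i r)"
proof (induction r arbitrary: \<mu>)
  case (Suc r)
  have "fact (Poly_Mapping.lookup \<mu> i) * Poly_Mapping.lookup ((pd i ^^ Suc r) T) \<mu> =
      fact (Suc (Poly_Mapping.lookup \<mu> i)) *
        Poly_Mapping.lookup ((pd i ^^ r) T) (\<mu> + Poly_Mapping.single i 1)"
    by (simp add: lookup_pd algebra_simps)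
  also have "\<dots> = fact (Poly_Mapping.lookup (\<mu> + Poly_Mapping.single i 1) i) *
        Poly_Mapping.lookup ((pd i ^^ r) T) (\<mu> + Poly_Mapping.single i 1)"
    by (simp add: lookup_add)
  also have "\<dots> = fact (Poly_Mapping.lookup \<mu> i + Suc r) *
      Poly_Mapping.lookup T (\<mu> + Poly_Mapping.single i 1 + Poly_Mapping.single i r)"
    unfolding Suc.IH by (simp add: lookup_add)
  also have "\<mu> + Poly_Mapping.single i 1 + Poly_Mapping.single i r = \<mu> + Poly_Mapping.single i (Suc r)"
    by (simp add: add.assoc flip: single_add)
  finally show ?case .
qed simp

lemma lookup_foldr_pd:
  assumes "distinct is" "\<And>i. i \<in> set is \<Longrightarrow> Poly_Mapping.lookup \<mu> i = 0"
  shows "Poly_Mapping.lookup (foldr (\<lambda>i D. (pd i ^^ a i) \<circ> D) is id T) \<mu> =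
    (\<Prod>i\<in>set is. fact (a i)) * Poly_Mapping.lookup T (\<mu> + (\<Sum>i\<in>set is. Poly_Mapping.single i (a i)))"
  using assms
proof (induction "is" arbitrary: \<mu>)
  case (Cons i "is")
  have "Poly_Mapping.lookup (foldr (\<lambda>i D. (pd i ^^ a i) \<circ> D) (i # is) id T) \<mu> =
      fact (a i) * Poly_Mapping.lookup (foldr (\<lambda>i D. (pd i ^^ a i) \<circ> D) is id T)
        (\<mu> + Poly_Mapping.single i (a i))"
    using lookup_funpow_pd[of \<mu> i "a i"] Cons.prems by simp
  also have "\<dots> = fact (a i) * ((\<Prod>i\<in>set is. fact (a i)) * Poly_Mapping.lookup T
      (\<mu> + Poly_Mapping.single i (a i) + (\<Sum>i\<in>set is. Poly_Mapping.single i (a i))))"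
    using Cons.prems by (subst Cons.IH) (auto simp: lookup_add lookup_single when_def)
  finally show ?case using Cons.prems(1) by (simp only: list.set sum.insert prod.insert distinct.simps
      finite_set not_False_eq_True ac_simps)
qed simp

text \<open>Differentiating \<open>mdeg \<alpha> \<le> m\<close> times leaves an error term of order
  at least 1, which vanishes at the origin. Only the formal derivative of \<open>T\<close>
  contributes there.\<close>

lemma taylor_coeff_eq:
  assumes T: "rat_approx Q g T (Suc m)" and Q: "poly_eval (\<lambda>_. 0) Q \<noteq> 0" and \<alpha>: "\<alpha> \<in> monomials n m"
  shows "taylor_coeff n g \<alpha> = Poly_Mapping.lookup T \<alpha>"
proof -
  let ?a = "Poly_Mapping.lookup \<alpha>"
  let ?D = "foldr (\<lambda>i D. (pd i ^^ ?a i) \<circ> D) [0..<n] id T"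
  have "mdeg \<alpha> = (\<Sum>i<n. ?a i)" using \<alpha> by (intro mdeg_superset) (auto simp: monomials_def)
  also have "\<dots> = sum_list (map ?a [0..<n])" by (simp add: sum_list_distinct_conv_sum_set atLeast0LessThan)
  finally have "1 \<le> Suc m - sum_list (map ?a [0..<n])" using \<alpha> by (simp add: monomials_def Suc_diff_le)
  then obtain R k where R: "ord_ge 1 R" and val: "\<And>x. poly_eval x Q \<noteq> 0 \<Longrightarrow>
      mixed_deriv n \<alpha> g x = poly_eval x ?D + poly_eval x R / poly_eval x Q ^ k"
    using rat_approx_foldr[OF T, of ?a "[0..<n]"] ord_ge_mono
    unfolding rat_approx_def mixed_deriv_def by blast
  have sum: "(\<Sum>i<n. Poly_Mapping.single i (?a i)) = \<alpha>"
    using \<alpha> by (intro poly_mapping_eqI) (auto simp: lookup_sum lookup_single when_def monomials_def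
        in_keys_iff)
  have "mixed_deriv n \<alpha> g (\<lambda>_. 0) = poly_eval (\<lambda>_. 0) ?D"
    using val[OF Q] R unfolding ord_ge_1_iff by simp
  also have "\<dots> = (\<Prod>i<n. fact (?a i)) * Poly_Mapping.lookup T \<alpha>"
    unfolding poly_eval_at_0 using sum by (subst lookup_foldr_pd) (auto simp: atLeast0LessThan)
  finally show ?thesis by (simp add: taylor_coeff_def)
qed

text \<open>Since \<open>P / Q = T + (P - Q * T) / Q\<close>, the analytic Taylor polynomial is
  determined by a purely algebraic congruence.\<close>

lemma taylor_poly_eqI:
  assumes Q: "poly_eval (\<lambda>_. 0) Q \<noteq> 0" and T: "T \<in> polys n m" and PQ: "ord_ge (Suc m) (P - Q * T)"
  shows "taylor_poly n m (\<lambda>x. poly_eval x P / poly_eval x Q) = T"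
proof -
  have "rat_approx Q (\<lambda>x. poly_eval x P / poly_eval x Q) T (Suc m)"
    unfolding rat_approx_def
    by (intro exI[of _ "P - Q * T"] exI[of _ 1] conjI PQ)
      (auto simp: poly_eval_diff poly_eval_mult field_simps)
  then have "taylor_poly n m (\<lambda>x. poly_eval x P / poly_eval x Q) =
      pm_of (monomials n m) (Poly_Mapping.lookup T)"
    unfolding taylor_poly_def pm_of_def using Q by (intro sum.cong refl) (simp add: taylor_coeff_eq)
  then show ?thesis using T by (simp add: pm_of_lookup finite_monomials polys_def)
qed

lemma polys_bpolys: "polys n d = bpolys {..<n} d"
  by (simp add: polys_def bpolys_def monomials_def monomials_over_def)

lemma ord_ge_truncation_error:
  assumes "T \<in> polys n k"
  shows "ord_ge (Suc m) (T - pm_of (monomials n m) (Poly_Mapping.lookup T))"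
  unfolding ord_ge_def
proof (rule ballI, rule ccontr)
  fix \<mu> assume \<mu>: "\<mu> \<in> Poly_Mapping.keys (T - pm_of (monomials n m) (Poly_Mapping.lookup T))"
    and "\<not> Suc m \<le> mdeg \<mu>"
  then have "\<mu> \<in> monomials n m"
    using assms keys_diff[of T "pm_of (monomials n m) (Poly_Mapping.lookup T)"]
      keys_pm_of[OF finite_monomials, of n m "Poly_Mapping.lookup T"]
    by (fastforce simp: monomials_def polys_def)
  then show False using \<mu> by (simp add: in_keys_iff lookup_minus lookup_pm_of finite_monomials)
qed

lemma taylor_truncation_exists:
  assumes P: "P \<in> polys n d" and Q: "Q \<in> polys n e" "poly_eval (\<lambda>_. 0) Q = 1"
  obtains T where "T \<in> polys n m" "ord_ge (Suc m) (P - Q * T)"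
proof -
  \<comment> \<open>The truncated geometric series for \<open>1 / Q\<close>; it converges formally
    because \<open>1 - Q\<close> has no constant term.\<close>
  define G where "G = (\<Sum>j<Suc m. (1 - Q) ^ j)"
  have "1 - (1 - Q) ^ Suc m = Q * G"
    using one_diff_power_eq[of "1 - Q" "Suc m"] by (simp add: G_def del: sum.lessThan_Suc)
  then have QG: "P - Q * (P * G) = P * (1 - Q) ^ Suc m"
    by (metis (no_types, opaque_lifting) diff_diff_eq2 add_diff_cancel_left' mult.left_commute
        mult.right_neutral right_diff_distrib)
  have "1 - Q \<in> bpolys {..<n} e"
    using bpolys_add[OF bpolys_1 bpolys_uminus, of Q] Q by (simp add: polys_bpolys)
  then have "G \<in> bpolys {..<n} (m * e)"
    unfolding G_def by (intro bpolys_sum bpolys_mono[OF bpolys_power]) auto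
  then have PG: "P * G \<in> polys n (d + m * e)"
    using P by (auto simp: polys_bpolys intro: bpolys_mult)
  define T where "T = pm_of (monomials n m) (Poly_Mapping.lookup (P * G))"
  have "T \<in> polys n m" by (simp add: T_def polys_def keys_pm_of finite_monomials)
  moreover have "ord_ge (Suc m) (P - Q * T)"
  proof -
    have "P - Q * T = P * (1 - Q) ^ Suc m + Q * (P * G - T)"
      unfolding QG[symmetric] by (simp add: algebra_simps)
    moreover have "ord_ge 1 (1 - Q)" unfolding ord_ge_1_iff using Q by (simp add: poly_eval_diff)
    then have "ord_ge (Suc m) (P * (1 - Q) ^ Suc m)"
      using ord_ge_mult[OF ord_ge_0 ord_ge_power, of "1 - Q" "Suc m" P] by simp
    moreover have "ord_ge (Suc m) (Q * (P * G - T))"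
      using ord_ge_mult[OF ord_ge_0 ord_ge_truncation_error[OF PG, of m], of Q] by (simp add: T_def)
    ultimately show ?thesis by (simp only: ord_ge_add)
  qed
  ultimately show ?thesis by (rule that)
qed

text \<open>Subtraction of exponents is truncated, so the condition
  \<open>\<gamma> + (\<beta> - \<gamma>) = \<beta>\<close> expresses that the monomial of
  \<open>\<gamma>\<close> divides that of \<open>\<beta>\<close>.\<close>

lemma lookup_mult_sum:
  fixes Q T :: "'i cpoly"
  assumes "finite A" "Poly_Mapping.keys Q \<subseteq> A"
  shows "Poly_Mapping.lookup (Q * T) \<beta> = (\<Sum>\<gamma>\<in>{\<gamma>\<in>A. \<gamma> + (\<beta> - \<gamma>) = \<beta>}.
    Poly_Mapping.lookup Q \<gamma> * Poly_Mapping.lookup T (\<beta> - \<gamma>))"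
proof -
  have Q: "Q = pm_of A (Poly_Mapping.lookup Q)" using assms by (simp add: pm_of_lookup)
  have single: "Poly_Mapping.lookup (Poly_Mapping.single \<gamma> c * T) \<beta> =
      (if \<gamma> + (\<beta> - \<gamma>) = \<beta> then c * Poly_Mapping.lookup T (\<beta> - \<gamma>) else 0)" for \<gamma> c
  proof -
    have "Poly_Mapping.single \<gamma> c * T =
        (\<Sum>\<delta>\<in>Poly_Mapping.keys T. Poly_Mapping.single (\<gamma> + \<delta>) (c * Poly_Mapping.lookup T \<delta>))"
      by (subst cpoly_eq_sum_single[of T]) (simp add: sum_distrib_left mult_single)
    then have "Poly_Mapping.lookup (Poly_Mapping.single \<gamma> c * T) \<beta> =
        (\<Sum>\<delta>\<in>Poly_Mapping.keys T. if \<gamma> + \<delta> = \<beta> then c * Poly_Mapping.lookup T \<delta> else 0)"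
      by (simp add: lookup_sum lookup_single when_def)
    also have "\<dots> = (\<Sum>\<delta>\<in>Poly_Mapping.keys T.
        if \<delta> = \<beta> - \<gamma> then (if \<gamma> + (\<beta> - \<gamma>) = \<beta> then c * Poly_Mapping.lookup T \<delta> else 0) else 0)"
      by (rule sum.cong[OF refl]) (metis add_diff_cancel_left')
    finally show ?thesis by (auto simp: in_keys_iff)
  qed
  show ?thesis
    by (subst Q) (simp add: pm_of_def sum_distrib_right lookup_sum single sum.inter_filter assms(1))
qed

section \<open>Taylor varieties with \<open>m = d + 1\<close>\<close>

text \<open>For \<open>m = d + 1\<close> the condition that \<open>T\<close> is the Taylor polynomial of some \<open>P/Q\<close> is that the part
  of degree \<open>m\<close> of \<open>Q T\<close> vanishes. The parameters \<open>Inl \<beta>\<close> are the coefficients of \<open>T\<close> in degrees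
  \<open>1, \<dots>, d\<close>, and the parameters \<open>Inr \<gamma>\<close> are the nonconstant coefficients of \<open>Q\<close>.\<close>

type_synonym tparam = "(nat \<Rightarrow>\<^sub>0 nat) + (nat \<Rightarrow>\<^sub>0 nat)"

definition denom_monomials :: "nat \<Rightarrow> nat \<Rightarrow> (nat \<Rightarrow>\<^sub>0 nat) \<Rightarrow> (nat \<Rightarrow>\<^sub>0 nat) set" where
  "denom_monomials n e \<beta> = {\<gamma> \<in> monomials n e. \<gamma> \<noteq> 0 \<and> \<gamma> + (\<beta> - \<gamma>) = \<beta>}"

definition low_coeff :: "(tparam \<Rightarrow> complex) \<Rightarrow> (nat \<Rightarrow>\<^sub>0 nat) \<Rightarrow> complex" where
  "low_coeff v \<beta> = (if \<beta> = 0 then 1 else v (Inl \<beta>))"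

definition tcoeff :: "nat \<Rightarrow> nat \<Rightarrow> nat \<Rightarrow> (tparam \<Rightarrow> complex) \<Rightarrow> (nat \<Rightarrow>\<^sub>0 nat) \<Rightarrow> complex" where
  "tcoeff n d e v \<beta> = (if mdeg \<beta> \<le> d then low_coeff v \<beta>
     else - (\<Sum>\<gamma>\<in>denom_monomials n e \<beta>. v (Inr \<gamma>) * low_coeff v (\<beta> - \<gamma>)))"

lemma finite_denom_monomials [simp]: "finite (denom_monomials n e \<beta>)"
  by (simp add: denom_monomials_def finite_monomials)

lemma mdeg_denom:
  assumes "\<gamma> \<in> denom_monomials n e \<beta>"
  shows "mdeg \<gamma> + mdeg (\<beta> - \<gamma>) = mdeg \<beta>" "mdeg \<gamma> > 0"
  using assms mdeg_add[of \<gamma> "\<beta> - \<gamma>"] mdeg_eq_0_iff[of \<gamma>] by (auto simp: denom_monomials_def)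

lemma denom_diff_monomials:
  assumes "\<gamma> \<in> denom_monomials n e \<beta>" "\<beta> \<in> monomials n (Suc d)"
  shows "\<beta> - \<gamma> \<in> monomials n d"
proof -
  have "Poly_Mapping.keys (\<beta> - \<gamma>) \<subseteq> Poly_Mapping.keys \<beta>"
    by (auto simp: in_keys_iff lookup_minus)
  then show ?thesis using assms mdeg_denom[OF assms(1)] by (auto simp: monomials_def)
qed

lemma zero_in_monomials [simp]: "0 \<in> monomials n m"
  by (simp add: monomials_def)

lemma mult_coeff_denom:
  assumes "Q \<in> polys n e" "poly_eval (\<lambda>_. 0) Q = 1"
  shows "Poly_Mapping.lookup (Q * T) \<beta> = Poly_Mapping.lookup T \<beta> +
    (\<Sum>\<gamma>\<in>denom_monomials n e \<beta>. Poly_Mapping.lookup Q \<gamma> * Poly_Mapping.lookup T (\<beta> - \<gamma>))"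
proof -
  have eq: "{\<gamma> \<in> monomials n e. \<gamma> + (\<beta> - \<gamma>) = \<beta>} = insert 0 (denom_monomials n e \<beta>)"
    by (auto simp: denom_monomials_def)
  have "0 \<notin> denom_monomials n e \<beta>" by (simp add: denom_monomials_def)
  moreover have "Poly_Mapping.keys Q \<subseteq> monomials n e" using assms(1) by (simp add: polys_def)
  ultimately show ?thesis
    unfolding lookup_mult_sum[OF finite_monomials \<open>Poly_Mapping.keys Q \<subseteq> _\<close>] eq
    using assms(2) by (simp add: poly_eval_at_0)
qed

text \<open>From \<open>P / Q\<close> the parameters are read off as coefficients of
  \<open>T\<close> and \<open>Q\<close>: as \<open>P\<close> has no part of degree
  \<open>d + 1\<close>, neither has \<open>Q * T\<close>, which determines the top coefficients of
  \<open>T\<close>.\<close>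

theorem taylor_points_param:
  "taylor_points n d e (Suc d) =
     range (\<lambda>v. proj_point (pm_of (monomials n (Suc d)) (tcoeff n d e v)))"
proof (intro equalityI subsetI)
  fix L assume "L \<in> taylor_points n d e (Suc d)"
  then obtain P Q where L: "L = proj_point (taylor_poly n (Suc d) (\<lambda>x. poly_eval x P / poly_eval x Q))"
    and P: "P \<in> polys n d" "poly_eval (\<lambda>_. 0) P = 1" and Q: "Q \<in> polys n e" "poly_eval (\<lambda>_. 0) Q = 1"
    by (auto simp: taylor_points_def)
  obtain T where T: "T \<in> polys n (Suc d)" and PQ: "ord_ge (Suc (Suc d)) (P - Q * T)"
    using taylor_truncation_exists[OF P(1) Q] .
  have "taylor_poly n (Suc d) (\<lambda>x. poly_eval x P / poly_eval x Q) = T"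
    using T PQ Q by (intro taylor_poly_eqI) auto
  have "ord_ge 1 (P - Q * T)" using PQ by (rule ord_ge_mono) simp
  then have "poly_eval (\<lambda>_. 0) T = 1"
    unfolding ord_ge_1_iff using P Q by (simp add: poly_eval_diff poly_eval_mult)
  then have T0: "Poly_Mapping.lookup T 0 = 1" by (simp only: poly_eval_at_0)
  define v where "v = case_sum (Poly_Mapping.lookup T) (Poly_Mapping.lookup Q)"
  have low: "low_coeff v \<beta> = Poly_Mapping.lookup T \<beta>" for \<beta>
    using T0 by (simp add: low_coeff_def v_def)
  have vQ: "v (Inr \<gamma>) = Poly_Mapping.lookup Q \<gamma>" for \<gamma> by (simp add: v_def)
  have "tcoeff n d e v \<beta> = Poly_Mapping.lookup T \<beta>" if \<beta>: "\<beta> \<in> monomials n (Suc d)" for \<beta>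
  proof (cases "mdeg \<beta> \<le> d")
    case False
    have "Poly_Mapping.lookup (P - Q * T) \<beta> = 0"
      using PQ \<beta> by (fastforce simp: ord_ge_def monomials_def simp flip: not_in_keys_iff_lookup_eq_zero)
    moreover have "Poly_Mapping.lookup P \<beta> = 0"
      using P(1) False by (auto simp: polys_def monomials_def in_keys_iff)
    ultimately have "Poly_Mapping.lookup (Q * T) \<beta> = 0" by (simp add: lookup_minus)
    then show ?thesis
      using False mult_coeff_denom[OF Q, of T \<beta>]
      by (simp add: tcoeff_def low vQ add_eq_0_iff2)
  qed (simp add: tcoeff_def low)
  then have "pm_of (monomials n (Suc d)) (tcoeff n d e v) = pm_of (monomials n (Suc d)) (Poly_Mapping.lookup T)"
    unfolding pm_of_def by (intro sum.cong) auto
  also have "\<dots> = T" using T by (simp add: pm_of_lookup finite_monomials polys_def)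
  finally show "L \<in> range (\<lambda>v. proj_point (pm_of (monomials n (Suc d)) (tcoeff n d e v)))"
    unfolding L \<open>taylor_poly _ _ _ = T\<close> by blast
next
  fix L assume "L \<in> range (\<lambda>v. proj_point (pm_of (monomials n (Suc d)) (tcoeff n d e v)))"
  then obtain v where L: "L = proj_point (pm_of (monomials n (Suc d)) (tcoeff n d e v))" by blast
  define T where "T = pm_of (monomials n (Suc d)) (tcoeff n d e v)"
  define Q where "Q = pm_of (monomials n e) (\<lambda>\<gamma>. if \<gamma> = 0 then 1 else v (Inr \<gamma>))"
  \<comment> \<open>The numerator is \<open>Q * T\<close> cut off after degree \<open>d\<close>. The
    part of degree \<open>d + 1\<close> vanishes by the choice of \<open>tcoeff\<close>, so the
    error has order at least \<open>d + 2\<close>.\<close>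
  define P where "P = pm_of (monomials n d) (Poly_Mapping.lookup (Q * T))"
  have T: "T \<in> polys n (Suc d)" and Q: "Q \<in> polys n e" and P: "P \<in> polys n d"
    by (simp_all add: T_def Q_def P_def polys_def keys_pm_of finite_monomials)
  have T0: "poly_eval (\<lambda>_. 0) T = 1"
    by (simp add: poly_eval_at_0 T_def lookup_pm_of finite_monomials tcoeff_def low_coeff_def)
  have Q0: "poly_eval (\<lambda>_. 0) Q = 1"
    by (simp add: poly_eval_at_0 Q_def lookup_pm_of finite_monomials)
  have "poly_eval (\<lambda>_. 0) (Q * T) = 1" using T0 Q0 by (simp add: poly_eval_mult)
  then have P0: "poly_eval (\<lambda>_. 0) P = 1"
    unfolding poly_eval_at_0 by (simp add: P_def lookup_pm_of finite_monomials)
  have QT: "Q * T \<in> polys n (e + Suc d)" using Q T unfolding polys_bpolys by (rule bpolys_mult)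
  have "ord_ge (Suc (Suc d)) (P - Q * T)"
    unfolding ord_ge_def
  proof (rule ballI, rule ccontr)
    fix \<beta> assume \<beta>: "\<beta> \<in> Poly_Mapping.keys (P - Q * T)" and "\<not> Suc (Suc d) \<le> mdeg \<beta>"
    have "Poly_Mapping.keys \<beta> \<subseteq> {..<n}"
      using \<beta> keys_diff[of P "Q * T"] P QT by (fastforce simp: polys_def monomials_def)
    with \<open>\<not> Suc (Suc d) \<le> mdeg \<beta>\<close> have \<beta>m: "\<beta> \<in> monomials n (Suc d)" by (simp add: monomials_def)
    have ne: "Poly_Mapping.lookup P \<beta> \<noteq> Poly_Mapping.lookup (Q * T) \<beta>"
      using \<beta> by (simp add: in_keys_iff lookup_minus)
    have "\<beta> \<notin> monomials n d" using ne by (auto simp: P_def lookup_pm_of finite_monomials)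
    then have "\<not> mdeg \<beta> \<le> d" using \<beta>m by (simp add: monomials_def)
    then have "Poly_Mapping.lookup P \<beta> = 0"
      using P by (auto simp: polys_def monomials_def in_keys_iff)
    moreover have "Poly_Mapping.lookup Q \<gamma> * Poly_Mapping.lookup T (\<beta> - \<gamma>) =
        v (Inr \<gamma>) * low_coeff v (\<beta> - \<gamma>)" if "\<gamma> \<in> denom_monomials n e \<beta>" for \<gamma>
    proof -
      have "mdeg (\<beta> - \<gamma>) \<le> d" "\<beta> - \<gamma> \<in> monomials n (Suc d)"
        using denom_diff_monomials[OF that \<beta>m] by (simp_all add: monomials_def)
      then have "Poly_Mapping.lookup T (\<beta> - \<gamma>) = low_coeff v (\<beta> - \<gamma>)"
        by (simp add: T_def lookup_pm_of finite_monomials tcoeff_def)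
      then show ?thesis
        using that by (simp add: Q_def lookup_pm_of finite_monomials denom_monomials_def)
    qed
    then have "Poly_Mapping.lookup (Q * T) \<beta> = Poly_Mapping.lookup T \<beta> +
        (\<Sum>\<gamma>\<in>denom_monomials n e \<beta>. v (Inr \<gamma>) * low_coeff v (\<beta> - \<gamma>))"
      unfolding mult_coeff_denom[OF Q Q0] by simp
    then have "Poly_Mapping.lookup (Q * T) \<beta> = 0"
      using \<open>\<not> mdeg \<beta> \<le> d\<close> \<beta>m by (simp add: T_def lookup_pm_of finite_monomials tcoeff_def)
    ultimately show False using ne by simp
  qed
  then have "taylor_poly n (Suc d) (\<lambda>x. poly_eval x P / poly_eval x Q) = T"
    using T Q0 by (intro taylor_poly_eqI) auto
  then show "L \<in> taylor_points n d e (Suc d)"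
    using P Q P0 Q0 unfolding taylor_points_def L T_def[symmetric] by blast
qed

text \<open>Parameters outside \<open>J\<close> are set to 0. A finite \<open>J\<close> gives the
  economical parametrisation for the upper bound, \<open>UNIV\<close> the full one.\<close>

definition param_var :: "tparam set \<Rightarrow> tparam \<Rightarrow> tparam cpoly" where
  "param_var J u = (if u \<in> J then pvar u else 0)"

definition low_poly :: "tparam set \<Rightarrow> (nat \<Rightarrow>\<^sub>0 nat) \<Rightarrow> tparam cpoly" where
  "low_poly J \<beta> = (if \<beta> = 0 then 1 else param_var J (Inl \<beta>))"

definition tcoeff_poly :: "tparam set \<Rightarrow> nat \<Rightarrow> nat \<Rightarrow> nat \<Rightarrow> (nat \<Rightarrow>\<^sub>0 nat) \<Rightarrow> tparam cpoly" where
  "tcoeff_poly J n d e \<beta> = (if mdeg \<beta> \<le> d then low_poly J \<beta>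
     else - (\<Sum>\<gamma>\<in>denom_monomials n e \<beta>. param_var J (Inr \<gamma>) * low_poly J (\<beta> - \<gamma>)))"

lemma poly_eval_tcoeff_poly:
  "poly_eval v (tcoeff_poly J n d e \<beta>) = tcoeff n d e (\<lambda>u. if u \<in> J then v u else 0) \<beta>"
proof -
  have pv: "poly_eval v (param_var J u) = (if u \<in> J then v u else 0)" for u
    by (simp add: param_var_def)
  then have "poly_eval v (low_poly J \<beta>) = low_coeff (\<lambda>u. if u \<in> J then v u else 0) \<beta>" for \<beta>
    by (simp add: low_poly_def low_coeff_def)
  then show ?thesis
    using pv by (simp add: tcoeff_poly_def tcoeff_def poly_eval_uminus poly_eval_sum poly_eval_mult)
qed

lemma poly_eval_tcoeff_poly_UNIV: "poly_eval v (tcoeff_poly UNIV n d e \<beta>) = tcoeff n d e v \<beta>"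
  by (simp add: poly_eval_tcoeff_poly)

lemma tcoeff_poly_bpolys: "tcoeff_poly J n d e \<beta> \<in> bpolys J 2"
proof -
  have pv: "param_var J u \<in> bpolys J 1" for u by (auto simp: param_var_def intro: bpolys_pvar[unfolded One_nat_def])
  have lp: "low_poly J \<beta> \<in> bpolys J 1" for \<beta> using pv by (simp add: low_poly_def)
  have "param_var J u * low_poly J \<beta> \<in> bpolys J 2" for u \<beta>
    using bpolys_mult[OF pv lp] by (simp add: numeral_2_eq_2)
  then show ?thesis
    using bpolys_mono[OF lp, of 2] by (auto simp: tcoeff_poly_def intro!: bpolys_uminus bpolys_sum)
qed

lemma tcoeff_cong:
  assumes "\<beta> \<in> monomials n (Suc d)"
    and "\<And>\<gamma>. \<gamma> \<in> monomials n d - {0} \<Longrightarrow> v (Inl \<gamma>) = w (Inl \<gamma>)"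
    and "\<And>\<gamma>. \<gamma> \<in> monomials n e - {0} \<Longrightarrow> v (Inr \<gamma>) = w (Inr \<gamma>)"
  shows "tcoeff n d e v \<beta> = tcoeff n d e w \<beta>"
proof -
  have low: "low_coeff v \<gamma> = low_coeff w \<gamma>" if "\<gamma> \<in> monomials n d" for \<gamma>
    using that assms(2) by (simp add: low_coeff_def)
  show ?thesis
  proof (cases "mdeg \<beta> \<le> d")
    case True
    then show ?thesis using low assms(1) by (simp add: tcoeff_def monomials_def)
  next
    case False
    have "v (Inr \<gamma>) * low_coeff v (\<beta> - \<gamma>) = w (Inr \<gamma>) * low_coeff w (\<beta> - \<gamma>)"
      if "\<gamma> \<in> denom_monomials n e \<beta>" for \<gamma>
      using that assms(3) low[OF denom_diff_monomials[OF that assms(1)]]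
      by (simp add: denom_monomials_def)
    then show ?thesis using False by (simp add: tcoeff_def)
  qed
qed

lemma taylor_points_proj_space: "taylor_points n d e (Suc d) \<subseteq> proj_space (monomials n (Suc d))"
  unfolding taylor_points_param
  by (auto intro!: pm_of_proj_space[where i = 0] finite_monomials simp: tcoeff_def low_coeff_def)

lemma closedin_taylor_variety: "closedin (taylor_space n m) (taylor_variety n d e m)"
  by (simp add: taylor_variety_def)

lemma irreducible_taylor_variety:
  "irreducible_in (taylor_space n (Suc d)) (taylor_variety n d e (Suc d))"
proof -
  have eq: "taylor_points n d e (Suc d) = (\<lambda>v. proj_point (pm_of (monomials n (Suc d))
      (\<lambda>\<beta>. poly_eval v (tcoeff_poly UNIV n d e \<beta>)))) ` UNIV"
    unfolding taylor_points_param poly_eval_tcoeff_poly_UNIV ..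
  show ?thesis
    using taylor_points_proj_space[of n d e] unfolding taylor_variety_def eq
    by (intro param_irreducible finite_monomials) auto
qed

text \<open>Adding the multiple \<open>c\<close> of the Koszul syzygy \<open>T\<^sub>b T\<^sub>a - T\<^sub>a T\<^sub>b = 0\<close> to the denominator.\<close>

definition koszul_shift :: "nat \<Rightarrow> nat \<Rightarrow> complex \<Rightarrow> (tparam \<Rightarrow> complex) \<Rightarrow> tparam \<Rightarrow> complex" where
  "koszul_shift a b c v u = (case u of Inl \<gamma> \<Rightarrow> v (Inl \<gamma>) | Inr \<gamma> \<Rightarrow>
     v (Inr \<gamma>) - (if mdeg \<gamma> = a then c * v (Inl \<gamma>) else 0) + (if mdeg \<gamma> = b then c * v (Inl \<gamma>) else 0))"

text \<open>The shift changes a top coefficient by a multiple of the difference of two sums of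
  products \<open>T_\<gamma> T_(\<beta> - \<gamma>)\<close>, over divisors of degree
  \<open>a\<close> and of degree \<open>b\<close>. The involution
  \<open>\<gamma> \<mapsto> \<beta> - \<gamma>\<close> exchanges these sums.\<close>

lemma tcoeff_koszul_shift:
  assumes ab: "a + b = Suc d" "1 \<le> a" "a \<le> e" "1 \<le> b" "b \<le> e" and \<beta>: "\<beta> \<in> monomials n (Suc d)"
  shows "tcoeff n d e (koszul_shift a b c v) \<beta> = tcoeff n d e v \<beta>"
proof -
  let ?G = "denom_monomials n e \<beta>"
  have low: "low_coeff (koszul_shift a b c v) \<gamma> = low_coeff v \<gamma>" for \<gamma>
    by (simp add: low_coeff_def koszul_shift_def)
  show ?thesis
  proof (cases "mdeg \<beta> \<le> d")
    case True
    then show ?thesis by (simp add: tcoeff_def low)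
  next
    case False
    then have deg: "mdeg \<beta> = a + b" using \<beta> ab by (simp add: monomials_def)
    let ?f = "\<lambda>\<gamma>. v (Inl \<gamma>) * low_coeff v (\<beta> - \<gamma>)"
    have flip: "(\<Sum>\<gamma>\<in>{\<gamma>\<in>?G. mdeg \<gamma> = a}. ?f \<gamma>) = (\<Sum>\<gamma>\<in>{\<gamma>\<in>?G. mdeg \<gamma> = b}. ?f \<gamma>)"
    proof (rule sum.reindex_bij_witness[of _ "\<lambda>\<gamma>. \<beta> - \<gamma>" "\<lambda>\<gamma>. \<beta> - \<gamma>"])
      have inv: "\<beta> - (\<beta> - \<gamma>) = \<gamma>" if "\<gamma> \<in> ?G" for \<gamma>
        using that by (auto simp: denom_monomials_def) (metis add_diff_cancel_right')
      have in_G: "\<beta> - \<gamma> \<in> ?G \<and> mdeg (\<beta> - \<gamma>) = l"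
        if \<gamma>: "\<gamma> \<in> ?G" "mdeg \<gamma> = k" and kl: "k + l = a + b" "1 \<le> l" "l \<le> e" for \<gamma> k l
      proof -
        have l: "mdeg (\<beta> - \<gamma>) = l" using mdeg_denom[OF \<gamma>(1)] \<gamma>(2) deg kl(1) by simp
        then have "\<beta> - \<gamma> \<noteq> 0" using kl(2) by auto
        moreover have "\<beta> - \<gamma> + (\<beta> - (\<beta> - \<gamma>)) = \<beta>"
          using inv[OF \<gamma>(1)] \<gamma>(1) by (simp add: denom_monomials_def add.commute)
        ultimately show ?thesis
          using denom_diff_monomials[OF \<gamma>(1) \<beta>] l kl(3) by (simp add: denom_monomials_def monomials_def)
      qed
      fix \<gamma>
      show "\<beta> - (\<beta> - \<gamma>) = \<gamma>" if "\<gamma> \<in> {\<gamma>\<in>?G. mdeg \<gamma> = a}" using that inv by simp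
      show "\<beta> - (\<beta> - \<gamma>) = \<gamma>" if "\<gamma> \<in> {\<gamma>\<in>?G. mdeg \<gamma> = b}" using that inv by simp
      show "\<beta> - \<gamma> \<in> {\<gamma>\<in>?G. mdeg \<gamma> = b}" if "\<gamma> \<in> {\<gamma>\<in>?G. mdeg \<gamma> = a}"
        using that in_G[of \<gamma> a b] ab by simp
      show "\<beta> - \<gamma> \<in> {\<gamma>\<in>?G. mdeg \<gamma> = a}" if "\<gamma> \<in> {\<gamma>\<in>?G. mdeg \<gamma> = b}"
        using that in_G[of \<gamma> b a] ab by simp
      show "?f (\<beta> - \<gamma>) = ?f \<gamma>" if \<gamma>: "\<gamma> \<in> {\<gamma>\<in>?G. mdeg \<gamma> = a}"
      proof -
        have "\<beta> - \<gamma> \<noteq> 0" using \<gamma> in_G[of \<gamma> a b] ab by (auto simp: denom_monomials_def)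
        moreover have "\<gamma> \<noteq> 0" using \<gamma> by (simp add: denom_monomials_def)
        ultimately show ?thesis using inv[of \<gamma>] \<gamma> by (simp add: low_coeff_def)
      qed
    qed
    have "(\<Sum>\<gamma>\<in>?G. koszul_shift a b c v (Inr \<gamma>) * low_coeff v (\<beta> - \<gamma>)) =
        (\<Sum>\<gamma>\<in>?G. v (Inr \<gamma>) * low_coeff v (\<beta> - \<gamma>)
          - c * (if mdeg \<gamma> = a then ?f \<gamma> else 0) + c * (if mdeg \<gamma> = b then ?f \<gamma> else 0))"
      by (rule sum.cong) (auto simp: koszul_shift_def algebra_simps)
    also have "\<dots> = (\<Sum>\<gamma>\<in>?G. v (Inr \<gamma>) * low_coeff v (\<beta> - \<gamma>))
        - c * (\<Sum>\<gamma>\<in>{\<gamma>\<in>?G. mdeg \<gamma> = a}. ?f \<gamma>) + c * (\<Sum>\<gamma>\<in>{\<gamma>\<in>?G. mdeg \<gamma> = b}. ?f \<gamma>)"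
      by (simp only: sum.distrib sum_subtractf sum_distrib_left[symmetric] sum.inter_filter
          finite_denom_monomials)
    finally show ?thesis using False by (simp add: tcoeff_def low flip)
  qed
qed

text \<open>Where the coefficient \<open>T\<^sub>\<omega>\<close> of the monomial \<open>\<omega>\<close> of degree \<open>a\<close> does not vanish, the Koszul syzygy
  removes the coefficient of \<open>\<omega>\<close> from the denominator.\<close>

theorem dim_taylor_variety_le:
  assumes ab: "a + b = Suc d" "1 \<le> a" "a \<le> e" "1 \<le> b" "b \<le> e" "a \<noteq> b"
    and \<omega>: "\<omega> \<in> monomials n e" "mdeg \<omega> = a"
  shows "dim_in (taylor_space n (Suc d)) (taylor_variety n d e (Suc d)) \<le>
    enat (card (monomials n d) + card (monomials n e) - 3)"
proof -
  let ?I = "monomials n (Suc d)"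
  \<comment> \<open>Both constant coefficients are normalised to 1 and the denominator coefficient
    at \<open>\<omega>\<close> is dropped; these three omissions are the \<open>- 3\<close> in the
    bound.\<close>
  define J :: "tparam set" where
    "J = Inl ` (monomials n d - {0}) \<union> Inr ` (monomials n e - {0, \<omega>})"
  have \<omega>0: "\<omega> \<noteq> 0" using \<omega> ab by auto
  have \<omega>d: "\<omega> \<in> monomials n d" using \<omega> ab by (simp add: monomials_def)
  have fJ: "finite J" by (simp add: J_def finite_monomials)
  have c1: "card (monomials n d - {0}) = card (monomials n d) - 1"
    by (simp add: card_Diff_subset)
  have c2: "card (monomials n e - {0, \<omega>}) = card (monomials n e) - 2"
    using \<omega>(1) \<omega>0 by (subst card_Diff_subset) (auto simp: card_insert_if)
  have "card {0 :: nat \<Rightarrow>\<^sub>0 nat} \<le> card (monomials n d)" by (rule card_mono) (auto simp: finite_monomials)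
  moreover have "card {0, \<omega>} \<le> card (monomials n e)"
    using \<omega>(1) by (intro card_mono finite_monomials) auto
  moreover have "card J = card (monomials n d - {0}) + card (monomials n e - {0, \<omega>})"
    unfolding J_def by (subst card_Un_disjoint) (auto simp: finite_monomials card_image)
  ultimately have cJ: "card J = card (monomials n d) + card (monomials n e) - 3"
    using c1 c2 \<omega>0 by simp
  have restrict: "tcoeff n d e (\<lambda>u. if u \<in> J then v u else 0) \<beta> = tcoeff n d e v \<beta>"
    if "\<beta> \<in> ?I" "v (Inr \<omega>) = 0" for v \<beta>
    using that(2) by (intro tcoeff_cong that(1)) (auto simp: J_def)
  have "dim_in (taylor_space n (Suc d)) (taylor_variety n d e (Suc d)) \<le> enat (card J)"
  proof (rule dim_le_params[OF closedin_taylor_variety fJ, where \<Phi> = "tcoeff_poly J n d e" and E = 2])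
    show "tcoeff_poly J n d e \<beta> \<in> bpolys J 2" for \<beta> by (rule tcoeff_poly_bpolys)
    fix F assume F: "F \<in> hom_polys ?I"
      and F0: "\<And>v. poly_eval (\<lambda>\<beta>. poly_eval v (tcoeff_poly J n d e \<beta>)) F = 0"
    have red: "poly_eval (tcoeff n d e v) F = 0" if "v (Inr \<omega>) = 0" for v
    proof -
      have "poly_eval (tcoeff n d e v) F = poly_eval (\<lambda>\<beta>. poly_eval v (tcoeff_poly J n d e \<beta>)) F"
        using restrict that by (intro poly_eval_cong_forms[OF F]) (simp add: poly_eval_tcoeff_poly)
      then show ?thesis using F0 by simp
    qed
    have generic: "poly_eval (tcoeff n d e v) F = 0" if "v (Inl \<omega>) \<noteq> 0" for v
    proof -
      \<comment> \<open>The multiple is chosen to cancel the denominator coefficient at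
        \<open>\<omega>\<close>. As \<open>a \<noteq> b\<close>, the correction in degree
        \<open>b\<close> does not touch it.\<close>
      define w where "w = koszul_shift a b (v (Inr \<omega>) / v (Inl \<omega>)) v"
      have "w (Inr \<omega>) = 0" using that \<omega>(2) ab(6) by (simp add: w_def koszul_shift_def)
      then have "poly_eval (tcoeff n d e w) F = 0" by (rule red)
      moreover have "poly_eval (tcoeff n d e w) F = poly_eval (tcoeff n d e v) F"
        unfolding w_def using tcoeff_koszul_shift[OF ab(1-5)] by (rule poly_eval_cong_forms[OF F])
      ultimately show ?thesis by simp
    qed
    have all: "poly_eval (tcoeff n d e v) F = 0" for v
    proof -
      \<comment> \<open>The exceptional value 0 of the coefficient at \<open>\<omega>\<close> is
        reached by polynomial continuation in that coefficient.\<close>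
      let ?l = "\<lambda>z. v(Inl \<omega> := z)"
      have "poly_eval (tcoeff n d e (?l (v (Inl \<omega>)))) F = 0"
      proof (rule polyfun_eq_0_punctured[of "\<lambda>z. poly_eval (tcoeff n d e (?l z)) F" 0])
        have "polyfun (\<lambda>z. ?l z u)" for u
          using polyfun_affine[of 0 1] by (cases "u = Inl \<omega>") auto
        then show "polyfun (\<lambda>z. poly_eval (tcoeff n d e (?l z)) F)"
          unfolding poly_eval_tcoeff_poly_UNIV[symmetric] by (intro polyfun_poly_eval)
        show "poly_eval (tcoeff n d e (?l z)) F = 0" if "z \<noteq> 0" for z using that generic by simp
      qed
      then show ?thesis by simp
    qed
    have "vanishes (taylor_points n d e (Suc d)) F"
      unfolding taylor_points_param vanishes_image[OF F] poly_eval_pm_of[OF finite_monomials F]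
      using all by simp
    then show "vanishes (taylor_variety n d e (Suc d)) F"
      unfolding taylor_variety_def by (intro vanishes_closure taylor_points_proj_space F)
  qed
  then show ?thesis by (simp add: cJ)
qed

text \<open>Around \<open>T = 1 + (\<Sum>\<sigma>\<in>S. x\<^sup>\<sigma>)\<close> and \<open>Q = 1\<close>, switching on the coefficients of \<open>Q\<close> one after another
  enlarges the set of attained top degree parts each time: the coefficient of \<open>x\<^sup>\<beta>\<close> is the first one that
  affects the coefficient of \<open>x\<^sup>\<gamma>\<close> of \<open>Q T\<close>, for each pair \<open>(\<beta>, \<gamma>)\<close> of the list.\<close>

theorem dim_taylor_variety_ge:
  assumes ed: "e \<le> d" and S: "S \<subseteq> monomials n d - {0}"
    and mem: "\<And>\<beta> \<gamma>. (\<beta>, \<gamma>) \<in> set ps \<Longrightarrow> \<beta> \<in> monomials n e \<and> \<beta> \<noteq> 0 \<and>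
      \<gamma> \<in> monomials n (Suc d) \<and> mdeg \<gamma> = Suc d \<and> (\<exists>\<sigma>\<in>S. \<gamma> = \<beta> + \<sigma>)"
    and tri: "sorted_wrt (\<lambda>p q. \<forall>\<sigma>\<in>S. fst p + \<sigma> \<noteq> snd q) ps"
  shows "enat (length ps + card (monomials n d) - 1) \<le>
    dim_in (taylor_space n (Suc d)) (taylor_variety n d e (Suc d))"
proof -
  let ?I = "monomials n (Suc d)"
  define v\<^sub>0 :: "tparam \<Rightarrow> complex" where "v\<^sub>0 = case_sum (\<lambda>\<beta>. of_bool (\<beta> \<in> S)) (\<lambda>_. 0)"
  obtain xs where xs: "set xs = monomials n d - {0}" "distinct xs"
    using finite_distinct_list[of "monomials n d - {0}"] finite_monomials by blast
  have len_xs: "length xs = card (monomials n d) - 1"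
    using distinct_card[OF xs(2)] xs(1) by (simp add: card_Diff_subset)
  define qs :: "(tparam \<times> _) list" where "qs = map (\<lambda>(\<beta>, \<gamma>). (Inr \<beta>, pvar \<gamma>)) ps"
  \<comment> \<open>After the denominator, the coefficients of \<open>T\<close> are freed one by
    one. Each is detected by its deviation from the base value, made homogeneous with the constant
    coordinate, which equals 1.\<close>
  define ts :: "(tparam \<times> _) list" where
    "ts = map (\<lambda>\<beta>. (Inl \<beta>, pvar \<beta> - Poly_Mapping.single 0 (v\<^sub>0 (Inl \<beta>)) * pvar 0)) xs"
  have len: "length qs = length ps" "length ts = length xs" by (simp_all add: qs_def ts_def)
  have nth_q: "(qs @ ts) ! i = (Inr \<beta>, pvar \<gamma>)" if "i < length ps" "ps ! i = (\<beta>, \<gamma>)" for i \<beta> \<gamma>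
  proof -
    have "(qs @ ts) ! i = qs ! i" using that(1) by (simp add: nth_append len)
    also have "\<dots> = (Inr \<beta>, pvar \<gamma>)" using that by (simp add: qs_def)
    finally show ?thesis .
  qed
  have nth_t: "(qs @ ts) ! i = ts ! (i - length ps)" if "\<not> i < length ps" for i
    using that by (simp add: nth_append len)
  have ev_t: "poly_eval (tcoeff n d e v) (pvar \<beta> - Poly_Mapping.single 0 c * pvar 0) = v (Inl \<beta>) - c"
    if "\<beta> \<in> set xs" for \<beta> c v
    using that xs(1)
    by (simp add: poly_eval_diff poly_eval_mult tcoeff_def low_coeff_def monomials_def)
  have in_X: "proj_point (pm_of ?I (tcoeff n d e v)) \<in> taylor_variety n d e (Suc d)" for v
    using closure_of_subset[of "taylor_points n d e (Suc d)" "taylor_space n (Suc d)"]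
      taylor_points_proj_space[of n d e]
    by (auto simp: taylor_variety_def taylor_points_param)
  have "enat (length (qs @ ts)) \<le> dim_in (taylor_space n (Suc d)) (taylor_variety n d e (Suc d))"
  proof (rule dim_ge_params[OF finite_monomials closedin_taylor_variety,
        where \<Phi> = "tcoeff_poly UNIV n d e" and v\<^sub>0 = v\<^sub>0], unfold poly_eval_tcoeff_poly_UNIV)
    show "proj_point (pm_of ?I (tcoeff n d e v)) \<in> taylor_variety n d e (Suc d)" for v by (rule in_X)
    show "f \<in> hom_polys ?I" if f: "f \<in> snd ` set (qs @ ts)" for f
    proof -
      consider \<beta> \<gamma> where "(\<beta>, \<gamma>) \<in> set ps" "f = pvar \<gamma>"
        | \<beta> where "\<beta> \<in> set xs" "f = pvar \<beta> + Poly_Mapping.single 0 (- v\<^sub>0 (Inl \<beta>)) * pvar 0"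
        using f by (force simp: qs_def ts_def single_uminus)
      then show ?thesis
      proof cases
        case 1
        then show ?thesis using mem by (auto intro!: forms_hom_polys[OF forms_pvar])
      next
        case 2
        then have "\<beta> \<in> ?I" using xs(1) by (simp add: monomials_def)
        then show ?thesis
          unfolding 2(2) by (intro forms_hom_polys[of _ _ 1] forms_add forms_smult forms_pvar) simp_all
      qed
    qed
  next
    fix i and v :: "tparam \<Rightarrow> complex"
    assume i: "i < length (qs @ ts)" and v: "\<And>u. u \<notin> fst ` set (take i (qs @ ts)) \<Longrightarrow> v u = v\<^sub>0 u"
    show "poly_eval (tcoeff n d e v) (snd ((qs @ ts) ! i)) = 0"
    proof (cases "i < length ps")
      case True
      obtain \<beta> \<gamma> where p: "ps ! i = (\<beta>, \<gamma>)" by fastforce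
      then have \<gamma>: "mdeg \<gamma> = Suc d" using mem True by (metis nth_mem)
      have take: "fst ` set (take i (qs @ ts)) = Inr ` fst ` set (take i ps)"
        using True by (force simp: len qs_def take_map)
      \<comment> \<open>Each product has a zero factor: either \<open>\<delta>\<close> is not yet
        freed, or triangularity keeps \<open>\<gamma> - \<delta>\<close> out of the support
        \<open>S\<close>, while \<open>T\<close> still has its base value.\<close>
      have "v (Inr \<delta>) * low_coeff v (\<gamma> - \<delta>) = 0" if \<delta>: "\<delta> \<in> denom_monomials n e \<gamma>" for \<delta>
      proof (cases "\<delta> \<in> fst ` set (take i ps)")
        case False
        then have "v (Inr \<delta>) = v\<^sub>0 (Inr \<delta>)" by (intro v) (unfold take, auto)
        then show ?thesis by (simp add: v\<^sub>0_def)
      next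
        case in_take: True
        then obtain p where "p \<in> set (take i ps)" "fst p = \<delta>" by blast
        then obtain j where j: "j < i" "fst (ps ! j) = \<delta>"
          unfolding in_set_conv_nth by auto
        \<comment> \<open>This excludes the constant monomial as quotient, whose coefficient is 1
          instead of 0.\<close>
        have "mdeg \<delta> \<le> d" using \<delta> ed by (auto simp: denom_monomials_def monomials_def)
        then have "\<gamma> - \<delta> \<noteq> 0" using mdeg_denom(1)[OF \<delta>] \<gamma> by auto
        moreover have "\<gamma> - \<delta> \<notin> S"
          using sorted_wrt_nth_less[OF tri j(1) True] j(2) p \<delta> by (auto simp: denom_monomials_def)
        moreover have "v (Inl (\<gamma> - \<delta>)) = v\<^sub>0 (Inl (\<gamma> - \<delta>))" by (intro v) (unfold take, auto)
        ultimately show ?thesis by (simp add: low_coeff_def v\<^sub>0_def)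
      qed
      then have "(\<Sum>\<delta>\<in>denom_monomials n e \<gamma>. v (Inr \<delta>) * low_coeff v (\<gamma> - \<delta>)) = 0"
        by (rule sum.neutral[rule_format])
      then have "tcoeff n d e v \<gamma> = 0" using \<gamma> by (simp add: tcoeff_def)
      then show ?thesis by (simp add: nth_q[OF True p])
    next
      case False
      define k where "k = i - length ps"
      have k: "k < length xs" using i False by (simp add: k_def len)
      have nth: "(qs @ ts) ! i = ts ! k" unfolding k_def using False by (rule nth_t)
      have "Inl (xs ! k) \<notin> fst ` set (take i (qs @ ts))"
        using False k xs(2)
        by (auto simp: len qs_def ts_def take_map k_def[symmetric] in_set_conv_nth nth_eq_iff_index_eq)
      then have "v (Inl (xs ! k)) = v\<^sub>0 (Inl (xs ! k))" by (rule v)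
      then show ?thesis unfolding nth using k by (simp add: ts_def ev_t)
    qed
  next
    fix i assume i: "i < length (qs @ ts)"
    show "\<exists>c. poly_eval (tcoeff n d e (v\<^sub>0(fst ((qs @ ts) ! i) := c))) (snd ((qs @ ts) ! i)) \<noteq> 0"
    proof (cases "i < length ps")
      case True
      obtain \<beta> \<gamma> where p: "ps ! i = (\<beta>, \<gamma>)" by fastforce
      then have "(\<beta>, \<gamma>) \<in> set ps" using True by (metis nth_mem)
      then obtain \<sigma> where \<beta>: "\<beta> \<in> monomials n e" "\<beta> \<noteq> 0" and \<gamma>: "mdeg \<gamma> = Suc d"
        and \<sigma>: "\<sigma> \<in> S" "\<gamma> = \<beta> + \<sigma>" using mem by blast
      let ?v = "v\<^sub>0(Inr \<beta> := 1)"
      have low: "low_coeff ?v \<sigma> = 1" using \<sigma>(1) S by (auto simp: low_coeff_def v\<^sub>0_def)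
      have mem_\<beta>: "\<beta> \<in> denom_monomials n e \<gamma>" using \<beta> \<sigma>(2) by (simp add: denom_monomials_def)
      \<comment> \<open>Only \<open>\<delta> = \<beta>\<close> has a nonzero denominator
        coefficient, and it meets the coefficient 1 of \<open>\<sigma>\<close>.\<close>
      have "(\<Sum>\<delta>\<in>denom_monomials n e \<gamma>. ?v (Inr \<delta>) * low_coeff ?v (\<gamma> - \<delta>)) =
          (\<Sum>\<delta>\<in>denom_monomials n e \<gamma>. if \<delta> = \<beta> then 1 else 0)"
        using low \<sigma>(2) by (intro sum.cong refl) (auto simp: v\<^sub>0_def)
      then have "tcoeff n d e ?v \<gamma> = - 1" using \<gamma> mem_\<beta> by (simp add: tcoeff_def)
      then show ?thesis by (intro exI[of _ 1]) (simp add: nth_q[OF True p])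
    next
      case False
      define k where "k = i - length ps"
      have k: "k < length xs" using i False by (simp add: k_def len)
      have nth: "(qs @ ts) ! i = ts ! k" unfolding k_def using False by (rule nth_t)
      show ?thesis
        unfolding nth using k
        by (intro exI[of _ "v\<^sub>0 (Inl (xs ! k)) + 1"]) (simp add: ts_def ev_t)
    qed
  qed
  moreover have "card (monomials n d) > 0"
    by (metis card_gt_0_iff empty_iff finite_monomials zero_in_monomials)
  ultimately show ?thesis by (simp add: len len_xs)
qed

section \<open>Three variables\<close>

type_synonym triple = "nat \<times> nat \<times> nat"

fun mon3 :: "triple \<Rightarrow> nat \<Rightarrow>\<^sub>0 nat" where
  "mon3 (a, b, c) = Poly_Mapping.single 0 a + Poly_Mapping.single 1 b + Poly_Mapping.single 2 c"

declare mon3.simps [simp del]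

fun deg3 :: "triple \<Rightarrow> nat" where
  "deg3 (a, b, c) = a + b + c"

fun add3 :: "triple \<Rightarrow> triple \<Rightarrow> triple" where
  "add3 (a, b, c) (a', b', c') = (a + a', b + b', c + c')"

lemma lookup_mon3: "Poly_Mapping.lookup (mon3 (a, b, c)) i =
    (if i = 0 then a else if i = 1 then b else if i = 2 then c else 0)"
  by (simp add: mon3.simps lookup_add lookup_single when_def)

lemma mon3_eq_iff [simp]: "mon3 s = mon3 t \<longleftrightarrow> s = t"
proof
  assume eq: "mon3 s = mon3 t"
  obtain a b c a' b' c' where st: "s = (a, b, c)" "t = (a', b', c')" by (cases s, cases t)
  show "s = t"
    using lookup_mon3[of a b c 0] lookup_mon3[of a b c 1] lookup_mon3[of a b c 2]
      lookup_mon3[of a' b' c' 0] lookup_mon3[of a' b' c' 1] lookup_mon3[of a' b' c' 2] eq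
    unfolding st by simp
qed simp

lemma mon3_add: "mon3 s + mon3 t = mon3 (add3 s t)"
  by (cases s, cases t) (simp add: mon3.simps single_add ac_simps)

lemma mdeg_mon3: "mdeg (mon3 t) = deg3 t"
  by (cases t) (simp add: mon3.simps mdeg_add)

lemma mon3_eq_0_iff: "mon3 t = 0 \<longleftrightarrow> deg3 t = 0"
  using mdeg_eq_0_iff[of "mon3 t"] by (simp add: mdeg_mon3)

lemma mon3_in_monomials: "mon3 t \<in> monomials 3 k \<longleftrightarrow> deg3 t \<le> k"
proof -
  obtain a b c where t: "t = (a, b, c)" by (cases t)
  have "Poly_Mapping.keys (mon3 t) \<subseteq> {..<3}"
    by (auto simp: t in_keys_iff lookup_mon3 split: if_splits)
  then show ?thesis by (simp add: monomials_def mdeg_mon3)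
qed

lemma monomials_3: "monomials 3 k = mon3 ` {t. deg3 t \<le> k}"
proof (intro equalityI subsetI)
  fix \<mu> assume \<mu>: "\<mu> \<in> monomials 3 k"
  let ?l = "Poly_Mapping.lookup \<mu>"
  have "\<mu> = mon3 (?l 0, ?l 1, ?l 2)"
  proof (rule poly_mapping_eqI)
    fix i
    have "?l i = 0" if "i \<ge> 3" using \<mu> that by (auto simp: monomials_def in_keys_iff)
    then show "?l i = Poly_Mapping.lookup (mon3 (?l 0, ?l 1, ?l 2)) i"
      unfolding lookup_mon3 by (cases "i \<ge> 3") (auto simp: numeral_eq_Suc not_le less_Suc_eq)
  qed
  then obtain t where t: "\<mu> = mon3 t" by blast
  then have "deg3 t \<le> k" using \<mu> by (simp only: mon3_in_monomials)
  then show "\<mu> \<in> mon3 ` {t. deg3 t \<le> k}" using t by blast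
qed (auto simp: mon3_in_monomials)

lemma card_monomials_3: "card (monomials 3 k) = (\<Sum>a\<le>k. \<Sum>b\<le>k - a. Suc (k - a - b))"
proof -
  have "{t. deg3 t \<le> k} = (SIGMA a:{..k}. SIGMA b:{..k - a}. {..k - a - b})"
    by (auto simp: le_diff_conv2)
  moreover have "card (monomials 3 k) = card {t. deg3 t \<le> k}"
    unfolding monomials_3 by (rule card_image) (simp add: inj_on_def)
  ultimately show ?thesis by (simp add: card_SigmaI)
qed

text \<open>The hypotheses of \<open>dim_taylor_variety_ge\<close> in terms of exponent triples, so
  that they can be checked by evaluation.\<close>

definition lower_certificate :: "nat \<Rightarrow> nat \<Rightarrow> triple list \<Rightarrow> (triple \<times> triple) list \<Rightarrow> bool" where
  "lower_certificate d e S ps \<longleftrightarrow> e \<le> d \<and> (\<forall>\<sigma>\<in>set S. 1 \<le> deg3 \<sigma> \<and> deg3 \<sigma> \<le> d) \<and>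
     (\<forall>(\<beta>, \<gamma>)\<in>set ps. 1 \<le> deg3 \<beta> \<and> deg3 \<beta> \<le> e \<and> deg3 \<gamma> = Suc d \<and> (\<exists>\<sigma>\<in>set S. \<gamma> = add3 \<beta> \<sigma>)) \<and>
     sorted_wrt (\<lambda>p q. \<forall>\<sigma>\<in>set S. add3 (fst p) \<sigma> \<noteq> snd q) ps"

lemma lower_certificate_dim:
  assumes "lower_certificate d e S ps"
  shows "enat (length ps + card (monomials 3 d) - 1) \<le>
    dim_in (taylor_space 3 (Suc d)) (taylor_variety 3 d e (Suc d))"
proof -
  let ?ps = "map (map_prod mon3 mon3) ps"
  note cert = assms[unfolded lower_certificate_def]
  note mem = cert[THEN conjunct2, THEN conjunct2, THEN conjunct1, rule_format]
  have "enat (length ?ps + card (monomials 3 d) - 1) \<le>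
    dim_in (taylor_space 3 (Suc d)) (taylor_variety 3 d e (Suc d))"
  proof (rule dim_taylor_variety_ge[where S = "mon3 ` set S"])
    show "e \<le> d" by (rule cert[THEN conjunct1])
    show "mon3 ` set S \<subseteq> monomials 3 d - {0}"
      using cert[THEN conjunct2, THEN conjunct1] by (auto simp: mon3_in_monomials mon3_eq_0_iff)
    show "sorted_wrt (\<lambda>p q. \<forall>\<sigma>\<in>mon3 ` set S. fst p + \<sigma> \<noteq> snd q) ?ps"
      using cert[THEN conjunct2, THEN conjunct2, THEN conjunct2] by (simp add: sorted_wrt_map mon3_add)
    fix \<beta> \<gamma> assume "(\<beta>, \<gamma>) \<in> set ?ps"
    then obtain s t where st: "(s, t) \<in> set ps" "\<beta> = mon3 s" "\<gamma> = mon3 t"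
      unfolding set_map by (elim imageE) (metis map_prod_simp prod.inject prod.exhaust)
    then have "1 \<le> deg3 s \<and> deg3 s \<le> e \<and> deg3 t = Suc d \<and> (\<exists>\<sigma>\<in>set S. t = add3 s \<sigma>)"
      using mem by fastforce
    then show "\<beta> \<in> monomials 3 e \<and> \<beta> \<noteq> 0 \<and> \<gamma> \<in> monomials 3 (Suc d) \<and> mdeg \<gamma> = Suc d \<and>
        (\<exists>\<sigma>\<in>mon3 ` set S. \<gamma> = \<beta> + \<sigma>)"
      unfolding st(2,3) by (auto simp: mon3_in_monomials mon3_eq_0_iff mdeg_mon3 mon3_add)
  qed
  then show ?thesis by simp
qed

definition triples :: "nat \<Rightarrow> triple list" where
  "triples k = concat (map (\<lambda>a. map (\<lambda>b. (a, b, k - a - b)) [0..<Suc (k - a)]) [0..<Suc k])"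

text \<open>\<open>T_1 = x\<close> and \<open>T_2 = y^2\<close>. The six quadratic denominator terms
  meet \<open>x\<close>, the linear ones \<open>y\<close> and \<open>z\<close> meet
  \<open>y^2\<close>; the term \<open>x\<close> is left out because of the Koszul syzygy.\<close>

definition support_223 :: "triple list" where
  "support_223 = [(1, 0, 0), (0, 2, 0)]"

definition pairs_223 :: "(triple \<times> triple) list" where
  "pairs_223 = map (\<lambda>t. (t, add3 t (1, 0, 0))) (triples 2) @
     [((0, 1, 0), (0, 3, 0)), ((0, 0, 1), (0, 2, 1))]"

text \<open>\<open>T\<^sub>4 = x\<^sup>4\<close>, \<open>T\<^sub>5 = y\<^sup>5\<close>, \<open>T\<^sub>6 = z\<^sup>6\<close>, \<open>T\<^sub>7 = x\<^sup>3y\<^sup>4 + xy\<^sup>2z\<^sup>4\<close>, \<open>T\<^sub>8 = x\<^sup>3yz\<^sup>4 + x\<^sup>2y\<^sup>3z\<^sup>3\<close>.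
  The last two were found by a search: their multiples of degree \<open>9\<close> have to be independent, in
  triangular form, modulo the ideal of the first three. The pair dropped from the second line
  accounts for the Koszul syzygy \<open>x\<^sup>4 y\<^sup>5 = y\<^sup>5 x\<^sup>4\<close>.\<close>

definition support_859 :: "triple list" where
  "support_859 = [(4, 0, 0), (0, 5, 0), (0, 0, 6), (3, 4, 0), (1, 2, 4), (3, 1, 4), (2, 3, 3)]"

definition pairs_859 :: "(triple \<times> triple) list" where
  "pairs_859 = map (\<lambda>t. (t, add3 t (4, 0, 0))) (triples 5) @
     map (\<lambda>t. (t, add3 t (0, 5, 0))) (removeAll (4, 0, 0) (triples 4)) @
     map (\<lambda>t. (t, add3 t (0, 0, 6))) (triples 3) @
     [((1, 1, 0), (2, 3, 4)), ((0, 0, 1), (3, 1, 5)), ((2, 0, 0), (3, 2, 4)),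
      ((0, 1, 0), (2, 4, 3)), ((1, 0, 0), (3, 3, 3)), ((0, 1, 1), (1, 3, 5)),
      ((1, 0, 1), (2, 2, 5)), ((0, 0, 2), (3, 4, 2)), ((0, 2, 0), (1, 4, 4))]"

lemma certificate_223: "lower_certificate 2 2 support_223 pairs_223"
  by code_simp

lemma certificate_859: "lower_certificate 8 5 support_859 pairs_859"
  by code_simp

lemma length_pairs: "length pairs_223 = 8" "length pairs_859 = 54"
  by code_simp+

lemma card_monomials_values:
  "card (monomials 3 2) = 10" "card (monomials 3 3) = 20" "card (monomials 3 5) = 56"
  "card (monomials 3 8) = 165" "card (monomials 3 9) = 220"
  unfolding card_monomials_3 by code_simp+

lemma krull_dim_taylor_space: "krull_dim (taylor_space n m) = enat (card (monomials n m) - 1)"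
  by (rule krull_dim_proj_space[OF finite_monomials zero_in_monomials])

text \<open>The syzygy in degrees 1 and 2 gives the upper bound \<open>10 + 10 - 3\<close>, the
  certificate the lower bound \<open>8 + 10 - 1\<close>.\<close>

lemma dim_taylor_223: "dim_in (taylor_space 3 3) (taylor_variety 3 2 2 3) = 17"
proof (rule antisym)
  show "dim_in (taylor_space 3 3) (taylor_variety 3 2 2 3) \<le> 17"
    using dim_taylor_variety_le[of 1 2 2 2 "mon3 (1, 0, 0)" 3]
      mon3_in_monomials[of "(1, 0, 0)" 2] mdeg_mon3[of "(1, 0, 0)"]
    by (simp add: card_monomials_values numeral_eq_enat eval_nat_numeral(3)[symmetric])
  show "17 \<le> dim_in (taylor_space 3 3) (taylor_variety 3 2 2 3)"
    using lower_certificate_dim[OF certificate_223]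
    by (simp add: card_monomials_values length_pairs numeral_eq_enat)
qed

text \<open>The syzygy in degrees 4 and 5 gives the upper bound \<open>165 + 56 - 3\<close>, the
  certificate the lower bound \<open>54 + 165 - 1\<close>.\<close>

lemma dim_taylor_859: "dim_in (taylor_space 3 9) (taylor_variety 3 8 5 9) = 218"
proof (rule antisym)
  show "dim_in (taylor_space 3 9) (taylor_variety 3 8 5 9) \<le> 218"
    using dim_taylor_variety_le[of 4 5 8 5 "mon3 (4, 0, 0)" 3]
      mon3_in_monomials[of "(4, 0, 0)" 5] mdeg_mon3[of "(4, 0, 0)"]
    by (simp add: card_monomials_values numeral_eq_enat)
  show "218 \<le> dim_in (taylor_space 3 9) (taylor_variety 3 8 5 9)"
    using lower_certificate_dim[OF certificate_859]
    by (simp add: card_monomials_values length_pairs numeral_eq_enat)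
qed

theorem proposition4p1:
  shows "(krull_dim (taylor_space 3 3) = 19
          \<and> expected_dim 3 2 2 3 = 18
          \<and> codim_in (taylor_space 3 3) (taylor_variety 3 2 2 3) = 2)
       \<and> (krull_dim (taylor_space 3 9) = 219
          \<and> expected_dim 3 8 5 9 = 219
          \<and> hypersurface_in (taylor_space 3 9) (taylor_variety 3 8 5 9))"
proof -
  have k: "krull_dim (taylor_space 3 3) = 19" "krull_dim (taylor_space 3 9) = 219"
    by (simp_all add: krull_dim_taylor_space card_monomials_values numeral_eq_enat)
  have binom: "(5 choose 3) = (10::nat)" "(6 choose 3) = (20::nat)" "(8 choose 3) = (56::nat)"
    "(11 choose 3) = (165::nat)" "(12 choose 3) = (220::nat)"
    by code_simp+
  have e: "expected_dim 3 2 2 3 = 18" "expected_dim 3 8 5 9 = 219"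
    by (simp_all add: expected_dim_def binom)
  have c: "codim_in (taylor_space 3 3) (taylor_variety 3 2 2 3) = 2"
    by (simp add: codim_in_def k dim_taylor_223 numeral_eq_enat)
  have "codim_in (taylor_space 3 9) (taylor_variety 3 8 5 9) = 1"
    by (simp add: codim_in_def k dim_taylor_859 numeral_eq_enat one_enat_def)
  moreover have "irreducible_in (taylor_space 3 9) (taylor_variety 3 8 5 9)"
    using irreducible_taylor_variety[of 3 8 5] by simp
  ultimately have "hypersurface_in (taylor_space 3 9) (taylor_variety 3 8 5 9)"
    by (simp add: hypersurface_in_def closedin_taylor_variety)
  then show ?thesis using k e c by blast
qed

end
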